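(* Let $\mathcal{X}\subseteq L^0_c$ be a linear space containing the constants and let $f\colon\mathcal{X}\to[-\infty,\infty]$. The following are equivalent: (i) $f$ admits a dual representation over $ca_c(\mathcal{X})$. (ii) $f=f_D$. (iii) There is a non-empty set $\mathcal{Q}\subseteq\mathfrak{P}_c(\Omega)$ such that $f=f^{\mathcal{Q}}_D$. (iv) $f$ is $\mathcal{P}$-sensitive and, for a (i.e., some) reduction set $\mathcal{Q}\subseteq\mathfrak{P}_c(\Omega)$ of $f$, there exists a $\mathcal{Q}$-localization $(f^Q)_{Q\in\mathcal{Q}}$ of $f$ such that each $f^Q$ admits a dual representation over $ca_Q(\mathcal{X})$, that is, $f^Q(X)=\sup_{\mu\in ca_Q(\mathcal{X})}\big(\int X\,d\mu-(f^Q)^*(\mu)\big)$, $X\in\mathcal{X}$, for some function $(f^Q)^*\colon ca_Q(\mathcal{X})\to[-\infty,\infty]$. In particular, let $\mathcal{Q}\subseteq\mathfrak{P}_c(\Omega)$ be non-empty and suppose that, for all $Q\in\mathcal{Q}$, $j_Q(\mathcal{X})$ admits a topology $\tau^Q$ such that $(j_Q(\mathcal{X}),\tau^Q)$ is a locally convex space with dual space $\mathcal{Y}^Q\subseteq ca_Q$ (continuous linear functionals being identified with integration against elements of $\mathcal{Y}^Q$). If there is a $\mathcal{Q}$-localization $(f^Q)_{Q\in\mathcal{Q}}$ of $f$ such that each $f^Q\circ j_Q^{-1}$ is convex, lower semicontinuous (with respect to $\tau^Q$), and takes the value $-\infty$ only if $f^Q\equiv-\infty$, then $f$ admits a dual representation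 over $ca_c(\mathcal{X})$.
   Context: $(\Omega,\mathcal{F})$ is a measurable space and $\mathcal{P}$ is a non-empty set of probability measures on it; $c(A):=\sup_{P\in\mathcal{P}}P(A)$ for $A\in\mathcal{F}$. An event $A\in\mathcal{F}$ is $\mathcal{P}$-polar if $c(A)=0$; a property holds $\mathcal{P}$-q.s. if it holds outside a $\mathcal{P}$-polar event. $ca_c$ is the space of finite signed (countably additive) measures $\mu$ on $(\Omega,\mathcal{F})$ whose total variation $|\mu|$ vanishes on all $\mathcal{P}$-polar events, and $\mathfrak{P}_c(\Omega)$ is the set of probability measures in $ca_c$. $L^0_c$ is the space of equivalence classes $[x]_c$ of real-valued random variables $x$ up to $\mathcal{P}$-q.s. equality. For $Q\in\mathfrak{P}_c(\Omega)$, $L^0_Q$ is the space of equivalence classes $[x]_Q$ up to $Q$-a.s. equality, $j_Q\colon L^0_c\to L^0_Q$, $[x]_c\mapsto[x]_Q$, and $ca_Q$ is the space of finite signed measures $\mu$ with $|\mu|\ll Q$. Sensitivity: $\mathcal{C}\subseteq\mathcal{X}$ is $\mathcal{P}$-sensitive if $\mathcal{C}=\emptyset$ or if for all $X\in\mathcal{X}$: $X\in\mathcal{C}\Leftrightarrow\forall Q\in\mathfrak{P}_c(\Omega)\colon j_Q(X)\in j_Q(\mathcal{C})$. A non-empty $\mathcal{Q}\subseteq\mathfrak{P}_c(\Omega)$ is a reduction set for $\mathcal{C}$ if for all $X\in\mathcal{X}$: $X\in\mathcal{C}\Leftrightarrow\forall Q\in\mathcal{Q}\colon j_Q(X)\in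 j_Q(\mathcal{C})$. With $E_r:=\{X\in\mathcal{X}\mid f(X)\le r\}$, $f$ is $\mathcal{P}$-sensitive if every $E_r$, $r\in\mathbb{R}$, is, and $\mathcal{Q}$ is a reduction set for $f$ if it is a reduction set for every $E_r$, $r\in\mathbb{R}$. A function $g\colon\mathcal{X}\to[-\infty,\infty]$ is $Q$-consistent if $j_Q(X)=j_Q(Y)$ implies $g(X)=g(Y)$; then $g\circ j_Q^{-1}$ denotes the induced function on $j_Q(\mathcal{X})$, $j_Q(X)\mapsto g(X)$. A $\mathcal{Q}$-localization of $f$ is a family $(f^Q)_{Q\in\mathcal{Q}}$ of functions $\mathcal{X}\to[-\infty,\infty]$ with each $f^Q$ $Q$-consistent and $f=\sup_{Q\in\mathcal{Q}}f^Q$ pointwise. Duality: $ca_c(\mathcal{X}):=\{\mu\in ca_c\mid\int X\,d\mu\text{ is well-defined and finite for all }X\in\mathcal{X}\}$ and $ca_Q(\mathcal{X}):=ca_Q\cap ca_c(\mathcal{X})$. $f$ admits a dual representation over $ca_c(\mathcal{X})$ if there is $f^*\colon ca_c(\mathcal{X})\to[-\infty,\infty]$ with $f(X)=\sup_{\mu\in ca_c(\mathcal{X})}\big(\int X\,d\mu-f^*(\mu)\big)$ for all $X\in\mathcal{X}$. The dual function is $\overline{f}(\mu):=\sup_{X\in\mathcal{X}}\big(\int X\,d\mu-f(X)\big)$, $\mu\in ca_c(\mathcal{X})$, and $f_D(X):=\sup_{\mu\in ca_c(\mathcal{X})}\big(\int X\,d\mu-\overline{f}(\mu)\big)$. For $Q\in\mathfrak{P}_c(\Omega)$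 set $f^Q_E(X):=\inf\{r\in\mathbb{R}\mid j_Q(X)\in j_Q(E_r)\}\in[-\infty,\infty]$ ($\inf\emptyset:=\infty$), $\overline{f}^Q(\mu):=\sup_{X\in\mathcal{X}}\big(\int X\,d\mu-f^Q_E(X)\big)$ for $\mu\in ca_Q(\mathcal{X})$, and $f^Q_D(X):=\sup_{\mu\in ca_Q(\mathcal{X})}\big(\int X\,d\mu-\overline{f}^Q(\mu)\big)$. For non-empty $\mathcal{Q}\subseteq\mathfrak{P}_c(\Omega)$, $f^{\mathcal{Q}}_D:=\sup_{Q\in\mathcal{Q}}f^Q_D$. *)

theory Defs
  imports "HOL-Probability.Probability"
begin

text \<open>A measurable space is given by a measure \<open>M\<close> of which only \<open>space M\<close> and \<open>sets M\<close>
  are used. Finite signed measures are real-valued set functions; making them extensional on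
  \<open>sets M\<close> ensures that equal signed measures are equal in HOL.\<close>

definition ca :: "'a measure \<Rightarrow> ('a set \<Rightarrow> real) set" where
  "ca M = {\<mu> \<in> extensional (sets M).
     \<forall>A. range A \<subseteq> sets M \<longrightarrow> disjoint_family A \<longrightarrow> (\<lambda>n::nat. \<mu> (A n)) sums \<mu> (\<Union>n. A n)}"

definition pos_var :: "'a measure \<Rightarrow> ('a set \<Rightarrow> real) \<Rightarrow> 'a set \<Rightarrow> ennreal" where
  "pos_var M \<mu> A = (SUP B\<in>{B \<in> sets M. B \<subseteq> A}. ennreal (\<mu> B))"

text \<open>Jordan decomposition \<open>\<mu> = \<mu>\<^sup>+ - \<mu>\<^sup>-\<close> and \<open>\<bar>\<mu>\<bar> = \<mu>\<^sup>+ + \<mu>\<^sup>-\<close>. The lemma \<open>emeasure_pos_part\<close>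
  below shows that \<^const>\<open>measure_of\<close> does not collapse to the null measure here.\<close>

definition pos_part :: "'a measure \<Rightarrow> ('a set \<Rightarrow> real) \<Rightarrow> 'a measure" where
  "pos_part M \<mu> = measure_of (space M) (sets M) (pos_var M \<mu>)"

definition neg_part :: "'a measure \<Rightarrow> ('a set \<Rightarrow> real) \<Rightarrow> 'a measure" where
  "neg_part M \<mu> = pos_part M (\<lambda>A. - \<mu> A)"

definition total_variation :: "'a measure \<Rightarrow> ('a set \<Rightarrow> real) \<Rightarrow> 'a set \<Rightarrow> ennreal" where
  "total_variation M \<mu> A = emeasure (pos_part M \<mu>) A + emeasure (neg_part M \<mu>) A"

definition signed_integrable :: "'a measure \<Rightarrow> ('a set \<Rightarrow> real) \<Rightarrow> ('a \<Rightarrow> real) \<Rightarrow> bool" where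
  "signed_integrable M \<mu> x \<longleftrightarrow> integrable (pos_part M \<mu>) x \<and> integrable (neg_part M \<mu>) x"

definition signed_integral :: "'a measure \<Rightarrow> ('a set \<Rightarrow> real) \<Rightarrow> ('a \<Rightarrow> real) \<Rightarrow> real" where
  "signed_integral M \<mu> x = integral\<^sup>L (pos_part M \<mu>) x - integral\<^sup>L (neg_part M \<mu>) x"

lemma emeasure_pos_part:
  assumes add: "\<And>A. range A \<subseteq> sets M \<Longrightarrow> disjoint_family A \<Longrightarrow>
      (\<lambda>n::nat. \<mu> (A n)) sums \<mu> (\<Union>n. A n)"
    and A: "A \<in> sets M"
  shows "emeasure (pos_part M \<mu>) A = pos_var M \<mu> A"
proof -
  have "(\<lambda>n::nat. \<mu> {}) sums \<mu> {}"
    using add[of "\<lambda>_. {}"] by (simp add: disjoint_family_on_def)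
  then have "(\<lambda>n::nat. \<mu> {}) \<longlonglongrightarrow> 0"
    by (auto dest: sums_summable summable_LIMSEQ_zero)
  then have mu0: "\<mu> {} = 0"
    by (simp add: LIMSEQ_const_iff)
  have mono: "pos_var M \<mu> B \<le> pos_var M \<mu> C" if "B \<subseteq> C" for B C
    unfolding pos_var_def using that by (intro SUP_subset_mono) auto
  have mu_Un: "\<mu> (B \<union> C) = \<mu> B + \<mu> C"
    if "B \<in> sets M" "C \<in> sets M" "B \<inter> C = {}" for B C
  proof -
    have r: "range (binaryset B C) \<subseteq> sets M" "disjoint_family (binaryset B C)"
      using that by (auto simp: range_binaryset_eq disjoint_family_on_def binaryset_def)
    have "(\<lambda>n. \<mu> (binaryset B C n)) sums \<mu> (B \<union> C)"
      using add[OF r] by (simp add: UN_binaryset_eq)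
    moreover have "(\<lambda>n. \<mu> (binaryset B C n)) sums (\<mu> B + \<mu> C)"
      by (rule binaryset_sums) (simp add: mu0)
    ultimately show ?thesis by (rule sums_unique2)
  qed
  have pos: "positive (sets M) (pos_var M \<mu>)"
  proof -
    have "{B \<in> sets M. B \<subseteq> {}} = {{}}" by auto
    then show ?thesis by (simp add: positive_def pos_var_def mu0)
  qed
  have superadd: "pos_var M \<mu> B + pos_var M \<mu> C \<le> pos_var M \<mu> (B \<union> C)"
    if "B \<in> sets M" "C \<in> sets M" "B \<inter> C = {}" for B C
  proof -
    have le: "ennreal (\<mu> D) + ennreal (\<mu> E) \<le> pos_var M \<mu> (B \<union> C)"
      if DE: "D \<in> sets M" "D \<subseteq> B" "E \<in> sets M" "E \<subseteq> C" for D E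
    proof -
      define D' where "D' = (if \<mu> D \<ge> 0 then D else {})"
      define E' where "E' = (if \<mu> E \<ge> 0 then E else {})"
      have "ennreal (\<mu> D) + ennreal (\<mu> E) = ennreal (\<mu> D') + ennreal (\<mu> E')"
        by (auto simp: D'_def E'_def mu0 ennreal_neg)
      also have "\<dots> = ennreal (\<mu> D' + \<mu> E')"
        by (intro ennreal_plus[symmetric]) (auto simp: D'_def E'_def mu0)
      also have "\<mu> D' + \<mu> E' = \<mu> (D' \<union> E')"
        using DE \<open>B \<inter> C = {}\<close> by (intro mu_Un[symmetric]) (auto simp: D'_def E'_def)
      also have "ennreal (\<mu> (D' \<union> E')) \<le> pos_var M \<mu> (B \<union> C)"
        unfolding pos_var_def using DE by (intro SUP_upper) (auto simp: D'_def E'_def)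
      finally show ?thesis .
    qed
    have "pos_var M \<mu> B + pos_var M \<mu> C = (SUP D\<in>{D \<in> sets M. D \<subseteq> B}. ennreal (\<mu> D) + pos_var M \<mu> C)"
      unfolding pos_var_def[of _ _ B] by (rule ennreal_SUP_add_left[symmetric]) auto
    also have "\<dots> \<le> pos_var M \<mu> (B \<union> C)"
    proof (intro SUP_least, clarify)
      fix D assume D: "D \<in> sets M" "D \<subseteq> B"
      have "ennreal (\<mu> D) + pos_var M \<mu> C = (SUP E\<in>{E \<in> sets M. E \<subseteq> C}. ennreal (\<mu> D) + ennreal (\<mu> E))"
        unfolding pos_var_def[of _ _ C] by (rule ennreal_SUP_add_right) auto
      also have "\<dots> \<le> pos_var M \<mu> (B \<union> C)"
        using le D by (intro SUP_least) auto
      finally show "ennreal (\<mu> D) + pos_var M \<mu> C \<le> pos_var M \<mu> (B \<union> C)" .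
    qed
    finally show ?thesis .
  qed
  have cadd: "countably_additive (sets M) (pos_var M \<mu>)"
    unfolding countably_additive_def
  proof (intro allI impI antisym)
    fix S :: "nat \<Rightarrow> 'a set"
    assume S: "range S \<subseteq> sets M" "disjoint_family S" "(\<Union>i. S i) \<in> sets M"
    have "(\<Sum>i<n. pos_var M \<mu> (S i)) \<le> pos_var M \<mu> (\<Union>i<n. S i)" for n
    proof (induction n)
      case 0
      show ?case by simp
    next
      case (Suc n)
      have "(\<Sum>i<Suc n. pos_var M \<mu> (S i)) \<le> pos_var M \<mu> (\<Union>i<n. S i) + pos_var M \<mu> (S n)"
        using Suc by (simp add: add_right_mono)
      also have "\<dots> \<le> pos_var M \<mu> ((\<Union>i<n. S i) \<union> S n)"
      proof (intro superadd)
        show "(\<Union>i<n. S i) \<inter> S n = {}"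
          using S(2) unfolding disjoint_family_on_def by (auto, metis disjoint_iff less_irrefl)
      qed (use S in auto)
      also have "(\<Union>i<n. S i) \<union> S n = (\<Union>i<Suc n. S i)"
        by (auto simp: lessThan_Suc)
      finally show ?case .
    qed
    also have "pos_var M \<mu> (\<Union>i<n. S i) \<le> pos_var M \<mu> (\<Union>i. S i)" for n
      by (intro mono) auto
    finally show "(\<Sum>i. pos_var M \<mu> (S i)) \<le> pos_var M \<mu> (\<Union>i. S i)"
      by (intro suminf_le_const) auto
    show "pos_var M \<mu> (\<Union>i. S i) \<le> (\<Sum>i. pos_var M \<mu> (S i))"
      unfolding pos_var_def[of _ _ "\<Union>i. S i"]
    proof (intro SUP_least, clarify)
      fix B assume B: "B \<in> sets M" "B \<subseteq> (\<Union>i. S i)"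
      have sm: "(\<lambda>n. \<mu> (B \<inter> S n)) sums \<mu> B"
      proof -
        have "(\<lambda>n. \<mu> (B \<inter> S n)) sums \<mu> (\<Union>n. B \<inter> S n)"
          using S B by (intro add) (auto simp: disjoint_family_on_def)
        also have "(\<Union>n. B \<inter> S n) = B" using B by auto
        finally show ?thesis .
      qed
      have "ennreal (\<Sum>i<n. \<mu> (B \<inter> S i)) \<le> (\<Sum>i. pos_var M \<mu> (S i))" for n
      proof -
        have "ennreal (\<Sum>i<n. \<mu> (B \<inter> S i)) \<le> ennreal (\<Sum>i<n. max 0 (\<mu> (B \<inter> S i)))"
          by (intro ennreal_leI sum_mono) auto
        also have "\<dots> = (\<Sum>i<n. ennreal (max 0 (\<mu> (B \<inter> S i))))"
          by (rule sum_ennreal[symmetric]) simp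
        also have "\<dots> \<le> (\<Sum>i<n. pos_var M \<mu> (S i))"
        proof (intro sum_mono)
          fix i
          have "ennreal (max 0 (\<mu> (B \<inter> S i))) = ennreal (\<mu> (B \<inter> S i))"
            by (simp add: max_def ennreal_neg)
          also have "\<dots> \<le> pos_var M \<mu> (S i)"
            unfolding pos_var_def using S B by (intro SUP_upper) auto
          finally show "ennreal (max 0 (\<mu> (B \<inter> S i))) \<le> pos_var M \<mu> (S i)" .
        qed
        also have "\<dots> \<le> (\<Sum>i. pos_var M \<mu> (S i))"
          by (intro sum_le_suminf) auto
        finally show ?thesis .
      qed
      moreover have "(\<lambda>n. ennreal (\<Sum>i<n. \<mu> (B \<inter> S i))) \<longlonglongrightarrow> ennreal (\<mu> B)"
        using sm unfolding sums_def by (rule tendsto_ennrealI)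
      ultimately show "ennreal (\<mu> B) \<le> (\<Sum>i. pos_var M \<mu> (S i))"
        by (intro LIMSEQ_le_const2) auto
    qed
  qed
  show ?thesis
    unfolding pos_part_def
    by (rule emeasure_measure_of_sigma[OF sets.sigma_algebra_axioms pos cadd A])
qed

definition upper_prob :: "'a measure set \<Rightarrow> 'a set \<Rightarrow> ennreal" where
  "upper_prob \<P> A = (SUP P\<in>\<P>. emeasure P A)"

definition polar :: "'a measure \<Rightarrow> 'a measure set \<Rightarrow> 'a set \<Rightarrow> bool" where
  "polar M \<P> A \<longleftrightarrow> A \<in> sets M \<and> upper_prob \<P> A = 0"

definition ca_c :: "'a measure \<Rightarrow> 'a measure set \<Rightarrow> ('a set \<Rightarrow> real) set" where
  "ca_c M \<P> = {\<mu> \<in> ca M. \<forall>A. polar M \<P> A \<longrightarrow> total_variation M \<mu> A = 0}"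

definition prob_c :: "'a measure \<Rightarrow> 'a measure set \<Rightarrow> 'a measure set" where
  "prob_c M \<P> = {Q. prob_space Q \<and> sets Q = sets M \<and> restrict (measure Q) (sets M) \<in> ca_c M \<P>}"

definition ca_Q :: "'a measure \<Rightarrow> 'a measure \<Rightarrow> ('a set \<Rightarrow> real) set" where
  "ca_Q M Q = {\<mu> \<in> ca M. \<forall>A\<in>sets M. emeasure Q A = 0 \<longrightarrow> total_variation M \<mu> A = 0}"

text \<open>Random variables modulo an equivalence relation \<open>R\<close>, which is either quasi-sure or
  \<open>Q\<close>-almost sure equality, and the induced vector space operations on equivalence classes.\<close>

type_synonym 'a rv_rel = "(('a \<Rightarrow> real) \<times> ('a \<Rightarrow> real)) set"
type_synonym 'a rv_class = "('a \<Rightarrow> real) set"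

definition qs_eq :: "'a measure \<Rightarrow> 'a measure set \<Rightarrow> 'a rv_rel" where
  "qs_eq M \<P> = {(x, y). x \<in> borel_measurable M \<and> y \<in> borel_measurable M \<and>
     (\<exists>N. polar M \<P> N \<and> (\<forall>\<omega>\<in>space M - N. x \<omega> = y \<omega>))}"

definition as_eq :: "'a measure \<Rightarrow> 'a rv_rel" where
  "as_eq Q = {(x, y). x \<in> borel_measurable Q \<and> y \<in> borel_measurable Q \<and> (AE \<omega> in Q. x \<omega> = y \<omega>)}"

definition L0_c :: "'a measure \<Rightarrow> 'a measure set \<Rightarrow> 'a rv_class set" where
  "L0_c M \<P> = borel_measurable M // qs_eq M \<P>"

definition const_cls :: "'a rv_rel \<Rightarrow> real \<Rightarrow> 'a rv_class" where
  "const_cls R a = R `` {\<lambda>_. a}"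

definition add_cls :: "'a rv_rel \<Rightarrow> 'a rv_class \<Rightarrow> 'a rv_class \<Rightarrow> 'a rv_class" where
  "add_cls R X Y = (\<Union>x\<in>X. \<Union>y\<in>Y. R `` {\<lambda>\<omega>. x \<omega> + y \<omega>})"

definition scale_cls :: "'a rv_rel \<Rightarrow> real \<Rightarrow> 'a rv_class \<Rightarrow> 'a rv_class" where
  "scale_cls R a X = (\<Union>x\<in>X. R `` {\<lambda>\<omega>. a * x \<omega>})"

definition linear_space :: "'a rv_rel \<Rightarrow> 'a rv_class set \<Rightarrow> bool" where
  "linear_space R S \<longleftrightarrow> const_cls R 0 \<in> S \<and> (\<forall>X\<in>S. \<forall>Y\<in>S. add_cls R X Y \<in> S) \<and>
     (\<forall>a. \<forall>X\<in>S. scale_cls R a X \<in> S)"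

text \<open>The image of \<open>[x]\<^sub>c\<close> under the coarser relation \<^term>\<open>as_eq Q\<close> is \<open>[x]\<^sub>Q\<close>.\<close>

definition j_map :: "'a measure \<Rightarrow> 'a rv_class \<Rightarrow> 'a rv_class" where
  "j_map Q X = as_eq Q `` X"

text \<open>Integrals of classes are evaluated on a representative; for \<open>\<mu>\<close> in \<^term>\<open>ca_c M \<P>\<close> (for
  quasi-sure classes) or \<^term>\<open>ca_Q M Q\<close> (for \<open>Q\<close>-a.s. classes) the choice does not matter.\<close>

definition cls_integral :: "'a measure \<Rightarrow> ('a set \<Rightarrow> real) \<Rightarrow> 'a rv_class \<Rightarrow> real" where
  "cls_integral M \<mu> X = signed_integral M \<mu> (SOME x. x \<in> X)"

definition ca_c_on ::
  "'a measure \<Rightarrow> 'a measure set \<Rightarrow> 'a rv_class set \<Rightarrow> ('a set \<Rightarrow> real) set" where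
  "ca_c_on M \<P> \<X> = {\<mu> \<in> ca_c M \<P>. \<forall>X\<in>\<X>. \<forall>x\<in>X. signed_integrable M \<mu> x}"

definition ca_Q_on ::
  "'a measure \<Rightarrow> 'a measure set \<Rightarrow> 'a measure \<Rightarrow> 'a rv_class set \<Rightarrow> ('a set \<Rightarrow> real) set" where
  "ca_Q_on M \<P> Q \<X> = ca_Q M Q \<inter> ca_c_on M \<P> \<X>"

definition sensitive ::
  "'a measure \<Rightarrow> 'a measure set \<Rightarrow> 'a rv_class set \<Rightarrow> 'a rv_class set \<Rightarrow> bool" where
  "sensitive M \<P> \<X> C \<longleftrightarrow> C = {} \<or> (\<forall>X\<in>\<X>. X \<in> C \<longleftrightarrow> (\<forall>Q\<in>prob_c M \<P>. j_map Q X \<in> j_map Q ` C))"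

definition reduction_set ::
  "'a measure \<Rightarrow> 'a measure set \<Rightarrow> 'a rv_class set \<Rightarrow> 'a measure set \<Rightarrow> 'a rv_class set \<Rightarrow> bool" where
  "reduction_set M \<P> \<X> \<Q> C \<longleftrightarrow> \<Q> \<noteq> {} \<and> \<Q> \<subseteq> prob_c M \<P> \<and>
     (\<forall>X\<in>\<X>. X \<in> C \<longleftrightarrow> (\<forall>Q\<in>\<Q>. j_map Q X \<in> j_map Q ` C))"

definition sublevel :: "'a rv_class set \<Rightarrow> ('a rv_class \<Rightarrow> ereal) \<Rightarrow> real \<Rightarrow> 'a rv_class set" where
  "sublevel \<X> f r = {X \<in> \<X>. f X \<le> ereal r}"

definition sensitive_fun ::
  "'a measure \<Rightarrow> 'a measure set \<Rightarrow> 'a rv_class set \<Rightarrow> ('a rv_class \<Rightarrow> ereal) \<Rightarrow> bool" where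
  "sensitive_fun M \<P> \<X> f \<longleftrightarrow> (\<forall>r. sensitive M \<P> \<X> (sublevel \<X> f r))"

definition reduction_set_fun ::
  "'a measure \<Rightarrow> 'a measure set \<Rightarrow> 'a rv_class set \<Rightarrow> 'a measure set \<Rightarrow> ('a rv_class \<Rightarrow> ereal) \<Rightarrow> bool"
  where
  "reduction_set_fun M \<P> \<X> \<Q> f \<longleftrightarrow> (\<forall>r. reduction_set M \<P> \<X> \<Q> (sublevel \<X> f r))"

definition consistent ::
  "'a rv_class set \<Rightarrow> 'a measure \<Rightarrow> ('a rv_class \<Rightarrow> ereal) \<Rightarrow> bool" where
  "consistent \<X> Q g \<longleftrightarrow> (\<forall>X\<in>\<X>. \<forall>Y\<in>\<X>. j_map Q X = j_map Q Y \<longrightarrow> g X = g Y)"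

definition induced ::
  "'a rv_class set \<Rightarrow> 'a measure \<Rightarrow> ('a rv_class \<Rightarrow> ereal) \<Rightarrow> 'a rv_class \<Rightarrow> ereal" where
  "induced \<X> Q g = g \<circ> inv_into \<X> (j_map Q)"

definition localization ::
  "'a rv_class set \<Rightarrow> 'a measure set \<Rightarrow> ('a measure \<Rightarrow> 'a rv_class \<Rightarrow> ereal) \<Rightarrow>
   ('a rv_class \<Rightarrow> ereal) \<Rightarrow> bool" where
  "localization \<X> \<Q> fQ f \<longleftrightarrow>
     (\<forall>Q\<in>\<Q>. consistent \<X> Q (fQ Q)) \<and> (\<forall>X\<in>\<X>. f X = (SUP Q\<in>\<Q>. fQ Q X))"

text \<open>Dual representations over a set \<open>D\<close> of signed measures integrating \<open>\<X>\<close>. The integral is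
  real, so the difference with an extended real is never of the form \<open>\<infinity> - \<infinity>\<close>.\<close>

definition dual_rep ::
  "'a measure \<Rightarrow> 'a rv_class set \<Rightarrow> ('a set \<Rightarrow> real) set \<Rightarrow> ('a rv_class \<Rightarrow> ereal) \<Rightarrow> bool" where
  "dual_rep M \<X> D g \<longleftrightarrow> (\<exists>h :: ('a set \<Rightarrow> real) \<Rightarrow> ereal.
     \<forall>X\<in>\<X>. g X = (SUP \<mu>\<in>D. ereal (cls_integral M \<mu> X) - h \<mu>))"

definition dual_fun ::
  "'a measure \<Rightarrow> 'a rv_class set \<Rightarrow> ('a rv_class \<Rightarrow> ereal) \<Rightarrow> ('a set \<Rightarrow> real) \<Rightarrow> ereal" where
  "dual_fun M \<X> g \<mu> = (SUP X\<in>\<X>. ereal (cls_integral M \<mu> X) - g X)"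

definition f_D ::
  "'a measure \<Rightarrow> 'a measure set \<Rightarrow> 'a rv_class set \<Rightarrow> ('a rv_class \<Rightarrow> ereal) \<Rightarrow> 'a rv_class \<Rightarrow> ereal"
  where
  "f_D M \<P> \<X> f X = (SUP \<mu>\<in>ca_c_on M \<P> \<X>. ereal (cls_integral M \<mu> X) - dual_fun M \<X> f \<mu>)"

definition f_E ::
  "'a rv_class set \<Rightarrow> ('a rv_class \<Rightarrow> ereal) \<Rightarrow> 'a measure \<Rightarrow> 'a rv_class \<Rightarrow> ereal" where
  "f_E \<X> f Q X = (INF r\<in>{r. j_map Q X \<in> j_map Q ` sublevel \<X> f r}. ereal r)"

definition f_QD ::
  "'a measure \<Rightarrow> 'a measure set \<Rightarrow> 'a rv_class set \<Rightarrow> ('a rv_class \<Rightarrow> ereal) \<Rightarrow> 'a measure \<Rightarrow>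
   'a rv_class \<Rightarrow> ereal" where
  "f_QD M \<P> \<X> f Q X =
     (SUP \<mu>\<in>ca_Q_on M \<P> Q \<X>. ereal (cls_integral M \<mu> X) - dual_fun M \<X> (f_E \<X> f Q) \<mu>)"

text \<open>Topological notions on a linear space \<open>S = topspace \<tau>\<close> of equivalence classes. As usual,
  locally convex spaces are not required to be Hausdorff.\<close>

definition convex_cls :: "'a rv_rel \<Rightarrow> 'a rv_class set \<Rightarrow> bool" where
  "convex_cls R C \<longleftrightarrow> (\<forall>X\<in>C. \<forall>Y\<in>C. \<forall>t\<in>{0..1}.
     add_cls R (scale_cls R t X) (scale_cls R (1 - t) Y) \<in> C)"

definition locally_convex_space ::
  "'a rv_rel \<Rightarrow> 'a rv_class set \<Rightarrow> 'a rv_class topology \<Rightarrow> bool" where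
  "locally_convex_space R S \<tau> \<longleftrightarrow> linear_space R S \<and> topspace \<tau> = S \<and>
     continuous_map (prod_topology \<tau> \<tau>) \<tau> (\<lambda>(X, Y). add_cls R X Y) \<and>
     continuous_map (prod_topology euclideanreal \<tau>) \<tau> (\<lambda>(a, X). scale_cls R a X) \<and>
     (\<forall>U. openin \<tau> U \<and> const_cls R 0 \<in> U \<longrightarrow>
        (\<exists>V C. openin \<tau> V \<and> const_cls R 0 \<in> V \<and> V \<subseteq> C \<and> C \<subseteq> U \<and> convex_cls R C))"

definition topological_dual ::
  "'a rv_rel \<Rightarrow> 'a rv_class topology \<Rightarrow> ('a rv_class \<Rightarrow> real) set" where
  "topological_dual R \<tau> = {\<phi> \<in> extensional (topspace \<tau>).
     (\<forall>X\<in>topspace \<tau>. \<forall>Y\<in>topspace \<tau>. \<phi> (add_cls R X Y) = \<phi> X + \<phi> Y) \<and>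
     (\<forall>a. \<forall>X\<in>topspace \<tau>. \<phi> (scale_cls R a X) = a * \<phi> X) \<and>
     continuous_map \<tau> euclideanreal \<phi>}"

definition dual_given_by ::
  "'a measure \<Rightarrow> 'a rv_rel \<Rightarrow> 'a rv_class topology \<Rightarrow> ('a set \<Rightarrow> real) set \<Rightarrow> bool" where
  "dual_given_by M R \<tau> Y \<longleftrightarrow>
     (\<forall>\<mu>\<in>Y. \<forall>Z\<in>topspace \<tau>. \<forall>z\<in>Z. signed_integrable M \<mu> z) \<and>
     topological_dual R \<tau> = (\<lambda>\<mu>. restrict (cls_integral M \<mu>) (topspace \<tau>)) ` Y"

text \<open>In \<^typ>\<open>ereal\<close>, \<open>\<infinity> + (-\<infinity>) = \<infinity>\<close>, so this is convexity of the epigraph.\<close>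

definition convex_fun_cls :: "'a rv_rel \<Rightarrow> 'a rv_class set \<Rightarrow> ('a rv_class \<Rightarrow> ereal) \<Rightarrow> bool" where
  "convex_fun_cls R S g \<longleftrightarrow> (\<forall>X\<in>S. \<forall>Y\<in>S. \<forall>t\<in>{0<..<1}.
     g (add_cls R (scale_cls R t X) (scale_cls R (1 - t) Y)) \<le> ereal t * g X + ereal (1 - t) * g Y)"

definition lower_semicont :: "'b topology \<Rightarrow> ('b \<Rightarrow> ereal) \<Rightarrow> bool" where
  "lower_semicont \<tau> g \<longleftrightarrow> (\<forall>r. closedin \<tau> {Z \<in> topspace \<tau>. g Z \<le> ereal r})"

end

theory Submission
  imports Defs "HOL-Library.Function_Algebras"
begin

text \<open>
The equivalences rest on a single estimate: if an affine function
\<open>X \<mapsto> \<integral>X d\<mu> - a\<close> with \<open>\<mu> \<in> ca_c(\<X>)\<close> lies below \<open>f\<close>, then the dual function of \<open>f\<close> at \<open>\<mu>\<close>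
is at most \<open>a\<close>, so the affine function even lies below \<open>f_D\<close> (\<open>minorant_le_f_D\<close>). As
\<open>f_D \<le> f\<close> always holds, \<open>f\<close> has a dual representation as soon as it is a supremum, in whatever
way, of such affine functions. This covers representations over \<open>ca_c(\<X>)\<close> and suprema of
localizations that are represented over the smaller spaces \<open>ca_Q(\<X>)\<close>.

Conversely, every \<open>\<mu> \<in> ca_c\<close> is absolutely continuous with respect to some \<open>Q \<in> prob_c M \<P>\<close>, namely
the normalised total variation (\<open>ca_c_dominated_by_prob\<close>). Hence \<open>ca_c(\<X>)\<close> is the union of the
spaces \<open>ca_Q(\<X>)\<close>. For \<open>\<mu>\<close> in \<open>ca_Q(\<X>)\<close> the integral \<open>\<integral>X d\<mu>\<close> depends on \<open>j_Q(X)\<close> only, and this has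
two consequences: \<open>f\<close> and \<open>f_E\<^sup>Q\<close> have the same dual function on \<open>ca_Q(\<X>)\<close> (\<open>dual_fun_f_E\<close>), so that
\<open>f_D\<close> is the supremum of all \<open>f_D\<^sup>Q\<close>; and \<open>prob_c M \<P>\<close> is a reduction set for each represented
function. The total variation can be normalised because a countably additive real-valued set
function is bounded (\<open>pos_var_finite\<close>).

The last claim is the Fenchel-Moreau theorem for each \<open>f\<^sup>Q\<close>, which supplies the affine minorants.
It follows from the Hahn-Banach theorem in the form of M. Riesz: a convex cone of pairs \<open>(x, l)\<close>
that meets the vertical axis only in nonnegative numbers lies above the graph of a linear
functional. The geometry is developed on a real vector space with an abstract family of convex
neighbourhoods of the origin and then transferred to the space \<open>j_Q(\<X>)\<close> of equivalence classes
along a linear surjection from the vector space of all functions \<open>\<Omega> \<rightarrow> \<real>\<close>. Continuous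
functionals descend along this surjection, because a linear functional that is bounded below on a
neighbourhood of the origin vanishes on every subspace contained in it, in particular on the
kernel.
\<close>

section \<open>The Hahn-Banach theorem for convex cones\<close>

text \<open>
By Zorn's lemma \<open>K\<close> is contained in a maximal convex cone \<open>L\<close> that meets the vertical axis only
in nonnegative numbers. Adding a point \<open>(x, l)\<close> outside \<open>L\<close> must destroy this property, which means
that \<open>L\<close> contains some \<open>(- x, m)\<close> with \<open>m < - l\<close>. So the lower boundary \<open>\<psi>\<close> of \<open>L\<close> satisfies
\<open>\<psi> (- x) \<le> - \<psi> x\<close>. Being sublinear, it is then linear.
\<close>
lemma linear_functional_below_convex_cone:
  fixes K :: "('v::real_vector \<times> real) set"
  assumes K: "convex_cone K"
    and pos: "\<And>l. (0, l) \<in> K \<Longrightarrow> 0 \<le> l"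
    and total: "\<And>x. \<exists>l. (x, l) \<in> K"
  obtains \<psi> where "linear \<psi>" "\<And>x l. (x, l) \<in> K \<Longrightarrow> \<psi> x \<le> l"
proof -
  define \<A> where "\<A> = {L. convex_cone L \<and> K \<subseteq> L \<and> (\<forall>l. (0, l) \<in> L \<longrightarrow> 0 \<le> l)}"
  have "\<exists>L\<in>\<A>. \<forall>L'\<in>\<A>. L \<subseteq> L' \<longrightarrow> L' = L"
  proof (rule subset_Zorn_nonempty)
    show "\<A> \<noteq> {}"
      using K pos unfolding \<A>_def by blast
    fix \<C> assume ne: "\<C> \<noteq> {}" and ch: "subset.chain \<A> \<C>"
    have sub: "\<C> \<subseteq> \<A>" and lin: "\<And>A B. A \<in> \<C> \<Longrightarrow> B \<in> \<C> \<Longrightarrow> A \<subseteq> B \<or> B \<subseteq> A"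
      using ch unfolding subset.chain_def by blast+
    have cc: "convex_cone A" if "A \<in> \<C>" for A
      using that sub unfolding \<A>_def by blast
    have "convex_cone (\<Union>\<C>)"
      unfolding convex_cone_iff
    proof (intro conjI ballI allI impI)
      show "0 \<in> \<Union>\<C>"
        using ne cc convex_cone_contains_0 by blast
      show "u + v \<in> \<Union>\<C>" if uv: "u \<in> \<Union>\<C>" "v \<in> \<Union>\<C>" for u v
      proof -
        obtain A B where AB: "u \<in> A" "A \<in> \<C>" "v \<in> B" "B \<in> \<C>"
          using uv by blast
        from lin[OF AB(2,4)] show ?thesis
        proof
          assume "A \<subseteq> B"
          then show ?thesis using AB convex_cone_add[OF cc[OF AB(4)], of u v] by blast
        next
          assume "B \<subseteq> A"
          then show ?thesis using AB convex_cone_add[OF cc[OF AB(2)], of u v] by blast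
        qed
      qed
      show "c *\<^sub>R u \<in> \<Union>\<C>" if "u \<in> \<Union>\<C>" "0 \<le> c" for u c
        using that cc convex_cone_scaleR by blast
    qed
    then show "\<Union>\<C> \<in> \<A>"
      using ne sub unfolding \<A>_def by blast
  qed
  then obtain L where L: "L \<in> \<A>" and max: "\<And>L'. L' \<in> \<A> \<Longrightarrow> L \<subseteq> L' \<Longrightarrow> L' = L"
    by blast
  have ccL: "convex_cone L" and KL: "K \<subseteq> L" and posL: "\<And>l. (0, l) \<in> L \<Longrightarrow> 0 \<le> l"
    using L unfolding \<A>_def by auto
  note addL = convex_cone_add[OF ccL] and scaleL = convex_cone_scaleR[OF ccL]
  (* Otherwise the cone spanned by L and (x, l) would be a proper extension of L. *)
  have dich: "(x, l) \<in> L \<or> (\<exists>m < - l. (- x, m) \<in> L)" for x l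
  proof (rule ccontr)
    assume neg: "\<not> ?thesis"
    define L' where "L' = (\<Union>u\<in>L. \<Union>v\<in>convex_cone hull {(x, l)}. {u + v})"
    have hull: "convex_cone hull {(x, l)} = {t *\<^sub>R (x, l) | t. 0 \<le> t}"
      by (auto simp: convex_cone_hull_separate_nonempty conic_hull_explicit)
    have "convex_cone L'"
      unfolding L'_def by (intro convex_cone_sums ccL convex_cone_convex_cone_hull)
    moreover have sub: "L \<subseteq> L'"
      unfolding L'_def using convex_cone_hull_contains_0[of "{(x, l)}"] by force
    moreover have "0 \<le> r" if "(0, r) \<in> L'" for r
    proof -
      obtain y m t where t: "(y, m) \<in> L" "0 \<le> t" "y + t *\<^sub>R x = 0" "r = m + t * l"
        using \<open>(0, r) \<in> L'\<close> unfolding L'_def hull by (auto simp: zero_prod_def)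
      show ?thesis
      proof (cases "t = 0")
        case True
        then show ?thesis using t posL by simp
      next
        case False
        have "(1 / t) *\<^sub>R (y, m) \<in> L"
          using t by (intro scaleL) auto
        moreover have "y = - (t *\<^sub>R x)"
          using t(3) by (simp add: eq_neg_iff_add_eq_0)
        ultimately have "(- x, m / t) \<in> L"
          using False by (simp add: divide_inverse mult.commute)
        then have "- l \<le> m / t"
          using neg by force
        then show ?thesis
          using t(2,4) False by (simp add: field_simps)
      qed
    qed
    ultimately have "L' \<in> \<A>"
      using KL unfolding \<A>_def by blast
    then have "L' = L"
      using max sub by blast
    moreover have "(x, l) \<in> L'"
    proof -
      have "0 \<in> L" using ccL by (rule convex_cone_contains_0)
      moreover have "(x, l) \<in> convex_cone hull {(x, l)}"
        by (simp add: hull_inc)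
      ultimately show ?thesis unfolding L'_def by force
    qed
    ultimately show False using neg by blast
  qed
  define \<psi> where "\<psi> x = Inf {l. (x, l) \<in> L}" for x
  have ne: "\<exists>l. (x, l) \<in> L" for x
    using total KL by blast
  have le: "0 \<le> l + m" if "(x, l) \<in> L" "(- x, m) \<in> L" for x l m
    using addL[OF that] posL by simp
  have bdd: "bdd_below {l. (x, l) \<in> L}" for x
  proof -
    obtain m where "(- x, m) \<in> L" using ne by blast
    then show ?thesis
      by (intro bdd_belowI[of _ "- m"]) (use le in force)
  qed
  have psi_le: "\<psi> x \<le> l" if "(x, l) \<in> L" for x l
    unfolding \<psi>_def using that bdd by (intro cInf_lower) auto
  have psi_greatest: "c \<le> \<psi> x" if "\<And>l. (x, l) \<in> L \<Longrightarrow> c \<le> l" for c x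
    unfolding \<psi>_def using that ne by (intro cInf_greatest) auto
  have odd_ge: "- \<psi> (- x) \<le> \<psi> x" for x
  proof (rule psi_greatest)
    fix l assume "(x, l) \<in> L"
    then have "- l \<le> \<psi> (- x)"
      by (intro psi_greatest) (use le in force)
    then show "- \<psi> (- x) \<le> l" by simp
  qed
  (* This is where maximality enters; all other properties of \<psi> hold for any admissible cone. *)
  have odd_le: "\<psi> x \<le> - \<psi> (- x)" for x
  proof (rule dense_le)
    fix l assume "l < \<psi> x"
    then have "(x, l) \<notin> L" using psi_le by fastforce
    then show "l \<le> - \<psi> (- x)"
      using dich psi_le by force
  qed
  have odd: "\<psi> (- x) = - \<psi> x" for x
    using odd_ge[of x] odd_le[of x] by simp
  have subadd: "\<psi> (x + y) \<le> \<psi> x + \<psi> y" for x y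
  proof -
    have "\<psi> (x + y) - m \<le> \<psi> x" if "(y, m) \<in> L" for m
      by (rule psi_greatest) (use psi_le addL[OF _ that] in force)
    then have "\<psi> (x + y) - \<psi> x \<le> \<psi> y"
      by (intro psi_greatest) force
    then show ?thesis by simp
  qed
  have additive: "\<psi> (x + y) = \<psi> x + \<psi> y" for x y
    using subadd[of x y] subadd[of "x + y" "- y"] odd[of y] by simp
  have scale_le: "\<psi> (a *\<^sub>R x) \<le> a * \<psi> x" if "0 < a" for a x
  proof -
    have "\<psi> (a *\<^sub>R x) / a \<le> \<psi> x"
    proof (rule psi_greatest)
      fix l assume "(x, l) \<in> L"
      then have "\<psi> (a *\<^sub>R x) \<le> a * l"
        using scaleL[of a "(x, l)"] that psi_le by simp
      then show "\<psi> (a *\<^sub>R x) / a \<le> l"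
        using that by (simp add: field_simps)
    qed
    then show ?thesis using that by (simp add: field_simps)
  qed
  have scale_pos: "\<psi> (a *\<^sub>R x) = a * \<psi> x" if "0 < a" for a x
    using scale_le[OF that, of x] scale_le[OF that, of "- x"] odd by simp
  have "\<psi> (a *\<^sub>R x) = a * \<psi> x" for a x
  proof -
    consider "a > 0" | "a = 0" | "- a > 0" by linarith
    then show ?thesis
    proof cases
      case 2
      then show ?thesis using odd[of 0] by simp
    next
      case 3
      then show ?thesis using scale_pos[of "- a" x] odd[of "a *\<^sub>R x"] by simp
    qed (rule scale_pos)
  qed
  then have "linear \<psi>"
    by (intro linearI additive) simp
  then show thesis
    using that psi_le KL by blast
qed

text \<open>
A sandwich theorem: \<open>A\<close> plays the role of an epigraph of a convex function and \<open>below\<close> says that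
this function dominates \<open>- k\<close> times the Minkowski gauge of \<open>C\<close>. The linear functional in between is
obtained from the convex cone generated by \<open>C \<times> {k}\<close> and the reflected epigraph; \<open>below\<close> and
\<open>0 \<le> k\<close> keep points \<open>(0, l)\<close> with \<open>l < 0\<close> out of this cone.
\<close>
lemma linear_functional_between_gauge_and_convex:
  fixes C :: "'v::real_vector set" and A :: "('v \<times> real) set"
  assumes C: "convex C" "\<And>x. \<exists>t>0. t *\<^sub>R x \<in> C" and A: "convex A" and k: "0 \<le> k"
    and below: "\<And>c s a. c \<in> C \<Longrightarrow> 0 \<le> s \<Longrightarrow> (s *\<^sub>R c, a) \<in> A \<Longrightarrow> - (s * k) \<le> a"
  obtains \<phi> where "linear \<phi>" "\<And>c. c \<in> C \<Longrightarrow> - k \<le> \<phi> c" "\<And>y a. (y, a) \<in> A \<Longrightarrow> \<phi> y \<le> a"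
proof -
  define B where "B = (\<lambda>(y, a). (- y, a)) ` A"
  define K where "K = convex_cone hull (C \<times> {k} \<union> B)"
  obtain c0 where c0: "c0 \<in> C" using C(2) by blast
  have "linear (\<lambda>(y, a). (- y, a) :: 'v \<times> real)"
    by (rule linearI) auto
  then have cB: "convex B"
    unfolding B_def using A by (rule convex_linear_image)
  have cC: "convex (C \<times> {k})"
    using C(1) by (intro convex_Times) auto
  have hullC: "convex_cone hull (C \<times> {k}) = {s *\<^sub>R u | s u. 0 \<le> s \<and> u \<in> C \<times> {k}}"
    using c0 by (subst convex_cone_hull_separate_nonempty)
      (auto simp: conic_hull_explicit convex_hull_eq[THEN iffD2, OF cC])
  have hullB: "convex_cone hull B \<subseteq> insert 0 {t *\<^sub>R u | t u. 0 \<le> t \<and> u \<in> B}"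
  proof (cases "B = {}")
    case True
    have "convex_cone hull ({} :: ('v \<times> real) set) \<subseteq> {0}"
      by (intro hull_minimal) auto
    then show ?thesis using True by auto
  next
    case False
    then show ?thesis
      by (subst convex_cone_hull_separate_nonempty)
        (auto simp: conic_hull_explicit convex_hull_eq[THEN iffD2, OF cB])
  qed
  have mem: "(s *\<^sub>R c, s * k) \<in> K" if "c \<in> C" "0 \<le> s" for c s
  proof -
    have "(c, k) \<in> K" unfolding K_def using that by (intro hull_inc) auto
    then show ?thesis
      using convex_cone_hull_mul[of "(c, k)" _ s] that unfolding K_def by simp
  qed
  have "convex_cone K"
    unfolding K_def by (rule convex_cone_convex_cone_hull)
  moreover have "0 \<le> l" if l: "(0, l) \<in> K" for l
  proof -
    obtain s c w where s: "0 \<le> s" "c \<in> C" "w \<in> convex_cone hull B" "(0, l) = (s *\<^sub>R c, s * k) + w"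
    proof -
      obtain v w where vw: "v \<in> convex_cone hull (C \<times> {k})" "w \<in> convex_cone hull B" "(0, l) = v + w"
        using l unfolding K_def convex_cone_hull_Un by blast
      then obtain s c where "0 \<le> s" "v = s *\<^sub>R (c, k)" "c \<in> C"
        unfolding hullC by blast
      with vw that[of s c w] show thesis by simp
    qed
    consider "w = 0" | t u where "0 < t" "u \<in> B" "w = t *\<^sub>R u"
    proof -
      from hullB s(3) consider "w = 0" | t u where "0 \<le> t" "u \<in> B" "w = t *\<^sub>R u"
        by blast
      then show thesis
        using that by cases (metis less_eq_real_def scaleR_zero_left)+
    qed
    then show ?thesis
    proof cases
      case 1
      then show ?thesis using s k by (simp add: zero_prod_def)
    next
      case 2
      then obtain y a where y: "(y, a) \<in> A" "s *\<^sub>R c = t *\<^sub>R y" "l = s * k + t * a"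
      proof -
        from 2(2) obtain y a where ya: "(y, a) \<in> A" "u = (- y, a)"
          unfolding B_def by auto
        then have "0 = s *\<^sub>R c - t *\<^sub>R y" "l = s * k + t * a"
          using s(4) 2(3) by simp_all
        then show thesis using that[of y a] ya(1) by simp
      qed
      have "y = (s / t) *\<^sub>R c"
      proof -
        have "(s / t) *\<^sub>R c = (1 / t) *\<^sub>R (s *\<^sub>R c)" by simp
        also have "\<dots> = y" unfolding y(2) using 2(1) by simp
        finally show ?thesis by simp
      qed
      then have "- (s / t * k) \<le> a"
        using below[of c "s / t" a] y s 2(1) by simp
      then show ?thesis
        using y(3) 2(1) by (simp add: field_simps)
    qed
  qed
  moreover have "\<exists>l. (x, l) \<in> K" for x
  proof -
    obtain t where "t > 0" "t *\<^sub>R x \<in> C" using C(2) by blast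
    then show ?thesis using mem[of "t *\<^sub>R x" "1 / t"] by auto
  qed
  ultimately obtain \<psi> where psi: "linear \<psi>" "\<And>x l. (x, l) \<in> K \<Longrightarrow> \<psi> x \<le> l"
    using linear_functional_below_convex_cone by blast
  show thesis
  proof
    show "linear (\<lambda>x. - \<psi> x)"
      using psi(1) by (rule linear_compose_neg)
    show "- k \<le> - \<psi> c" if "c \<in> C" for c
      using psi(2) mem[OF that, of 1] by fastforce
    show "- \<psi> y \<le> a" if "(y, a) \<in> A" for y a
    proof -
      have "(- y, a) \<in> K"
        unfolding K_def B_def using that by (intro hull_inc) force
      then show ?thesis
        using psi by (metis linear_neg)
    qed
  qed
qed

section \<open>The Fenchel-Moreau theorem\<close>

text \<open>
The convex neighbourhoods of the origin of a locally convex topology, described by the algebraic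
properties that are needed below. Linear functionals bounded below on a member of \<open>N\<close> are the
continuous ones.
\<close>
locale convex_zero_nhds =
  fixes N :: "'v::real_vector set set"
  assumes convex_nhd: "C \<in> N \<Longrightarrow> convex C"
    and absorbing_nhd: "C \<in> N \<Longrightarrow> \<exists>t>0. t *\<^sub>R x \<in> C"
    and Int_nhd: "C \<in> N \<Longrightarrow> D \<in> N \<Longrightarrow> C \<inter> D \<in> N"
    and scale_nhd: "C \<in> N \<Longrightarrow> a \<noteq> 0 \<Longrightarrow> (\<lambda>x. a *\<^sub>R x) ` C \<in> N"
begin

lemma zero_in_nhd: "C \<in> N \<Longrightarrow> 0 \<in> C"
  using absorbing_nhd[of C 0] by simp

lemma shrink_nhd: "C \<in> N \<Longrightarrow> c \<in> C \<Longrightarrow> 0 \<le> t \<Longrightarrow> t \<le> 1 \<Longrightarrow> t *\<^sub>R c \<in> C"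
  using convexD[OF convex_nhd, of C 0 c "1 - t" t] zero_in_nhd by simp

text \<open>
Intersecting a small multiple of the neighbourhood with its reflection turns a lower bound into a
small two-sided bound. This is continuity at the origin.
\<close>
lemma bounded_below_imp_small:
  assumes "linear \<phi>" "C \<in> N" "\<And>c. c \<in> C \<Longrightarrow> - k \<le> \<phi> c" "0 < e"
  shows "\<exists>D\<in>N. \<forall>d\<in>D. \<bar>\<phi> d\<bar> \<le> (e::real)"
proof -
  define t where "t = e / (\<bar>k\<bar> + 1)"
  have t: "t > 0" "t * \<bar>k\<bar> \<le> e"
    using assms(4) by (auto simp: t_def field_simps)
  have lower: "- e \<le> t * \<phi> c" if "c \<in> C" for c
  proof -
    have "t * (- \<bar>k\<bar>) \<le> t * \<phi> c"
      using t assms(3)[OF that] by (intro mult_left_mono) auto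
    then show ?thesis using t by simp
  qed
  define D where "D = ((\<lambda>x. t *\<^sub>R x) ` C) \<inter> ((\<lambda>x. (- t) *\<^sub>R x) ` C)"
  have "D \<in> N"
    unfolding D_def using t assms(2) by (intro Int_nhd scale_nhd) auto
  moreover have "\<bar>\<phi> d\<bar> \<le> e" if "d \<in> D" for d
  proof -
    obtain c c' where c: "c \<in> C" "d = t *\<^sub>R c" "c' \<in> C" "d = (- t) *\<^sub>R c'"
      using \<open>d \<in> D\<close> unfolding D_def by blast
    have "\<phi> d = t * \<phi> c"
      unfolding c(2) linear_scale[OF assms(1)] by simp
    moreover have "\<phi> d = - (t * \<phi> c')"
      unfolding c(4) linear_scale[OF assms(1)] by simp
    ultimately show ?thesis
      using lower[OF c(1)] lower[OF c(3)] by linarith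
  qed
  ultimately show ?thesis by blast
qed

text \<open>
The sandwich theorem for the translated epigraph \<open>{(y, a). g (x + y) \<le> a + b}\<close>.
\<close>
lemma affine_minorant_above_gauge:
  fixes g :: "'v \<Rightarrow> ereal"
  assumes convex_g: "\<And>x y t. 0 < t \<Longrightarrow> t < 1 \<Longrightarrow>
      g (t *\<^sub>R x + (1 - t) *\<^sub>R y) \<le> ereal t * g x + ereal (1 - t) * g y"
    and C: "C \<in> N" and k: "0 \<le> k"
    and below: "\<And>c s. c \<in> C \<Longrightarrow> 0 \<le> s \<Longrightarrow> ereal (b - s * k) \<le> g (x + s *\<^sub>R c)"
  obtains \<phi> where "linear \<phi>" "\<And>c. c \<in> C \<Longrightarrow> - k \<le> \<phi> c" "\<And>y. ereal (\<phi> (y - x) + b) \<le> g y"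
proof -
  define A where "A = {(y, a). g (x + y) \<le> ereal (a + b)}"
  have "convex A"
    unfolding convex_alt
  proof (intro ballI allI impI)
    fix u v t assume "u \<in> A" "v \<in> A" and t: "0 \<le> t \<and> t \<le> (1::real)"
    then obtain y a z c where u: "u = (y, a)" "g (x + y) \<le> ereal (a + b)"
      and v: "v = (z, c)" "g (x + z) \<le> ereal (c + b)"
      unfolding A_def by blast
    consider "t = 0" | "t = 1" | "0 < t" "t < 1" using t by linarith
    then show "(1 - t) *\<^sub>R u + t *\<^sub>R v \<in> A"
    proof cases
      case 3
      have "g (x + (t *\<^sub>R z + (1 - t) *\<^sub>R y)) = g (t *\<^sub>R (x + z) + (1 - t) *\<^sub>R (x + y))"
        by (simp add: algebra_simps)
      also have "\<dots> \<le> ereal t * g (x + z) + ereal (1 - t) * g (x + y)"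
        using 3 by (rule convex_g)
      also have "\<dots> \<le> ereal t * ereal (c + b) + ereal (1 - t) * ereal (a + b)"
        using u v 3 by (intro add_mono ereal_mult_left_mono) auto
      also have "\<dots> = ereal (((1 - t) * a + t * c) + b)"
        by (simp add: algebra_simps)
      finally show ?thesis
        unfolding A_def u v by (simp add: add.commute)
    qed (use \<open>u \<in> A\<close> \<open>v \<in> A\<close> in auto)
  qed
  moreover have "- (s * k) \<le> a" if "c \<in> C" "0 \<le> s" "(s *\<^sub>R c, a) \<in> A" for c s a
  proof -
    have "ereal (b - s * k) \<le> ereal (a + b)"
      using order_trans[OF below[OF that(1,2)]] that(3) unfolding A_def by blast
    then show ?thesis by simp
  qed
  ultimately obtain \<phi> where phi: "linear \<phi>" "\<And>c. c \<in> C \<Longrightarrow> - k \<le> \<phi> c"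
      "\<And>y a. (y, a) \<in> A \<Longrightarrow> \<phi> y \<le> a"
    using linear_functional_between_gauge_and_convex[OF convex_nhd[OF C] absorbing_nhd[OF C] _ k, of A]
    by blast
  have "ereal (\<phi> (y - x) + b) \<le> g y" for y
  proof (rule ereal_le_real)
    fix a assume "g y \<le> ereal a"
    then have "(y - x, a - b) \<in> A" unfolding A_def by simp
    then show "ereal (\<phi> (y - x) + b) \<le> ereal a"
      using phi(3) by fastforce
  qed
  with phi show thesis using that by blast
qed

text \<open>
The sandwich theorem is used twice, with different lower bounds. At a point \<open>z\<close> with \<open>g z\<close> finite,
lower semicontinuity bounds \<open>g\<close> near \<open>z\<close> and convexity extends this to a bound that decreases
linearly in the gauge, which yields some affine minorant \<open>h\<close>. The function \<open>u = g - h\<close> is nonnegative,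
so near an arbitrary \<open>x\<close>, where \<open>g\<close> may be infinite, a local bound \<open>\<rho> \<le> u\<close> with \<open>\<rho> > 0\<close> already
gives the global bound \<open>\<rho> (1 - gauge) \<le> u\<close>, since the left-hand side is nonpositive away from \<open>x\<close>.
An affine minorant of \<open>u\<close> with value \<open>\<rho>\<close> at \<open>x\<close>, added to \<open>h\<close>, reaches \<open>r\<close> at \<open>x\<close>.
\<close>
theorem Fenchel_Moreau_minorant:
  fixes g :: "'v \<Rightarrow> ereal"
  assumes convex_g: "\<And>x y t. 0 < t \<Longrightarrow> t < 1 \<Longrightarrow>
      g (t *\<^sub>R x + (1 - t) *\<^sub>R y) \<le> ereal t * g x + ereal (1 - t) * g y"
    and proper: "\<And>x. g x \<noteq> - \<infinity>"
    and lsc: "\<And>x r. ereal r < g x \<Longrightarrow> \<exists>C\<in>N. \<forall>c\<in>C. ereal r < g (x + c)"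
    and r: "ereal r < g x" and ne: "N \<noteq> {}"
  obtains \<phi> c C k where "linear \<phi>" "C \<in> N" "\<And>y. y \<in> C \<Longrightarrow> - k \<le> \<phi> y"
    "\<And>y. ereal (\<phi> y + c) \<le> g y" "r \<le> \<phi> x + c"
proof (cases "\<forall>z. g z = \<infinity>")
  case True
  obtain C where "C \<in> N" using ne by blast
  then show thesis
    using that[of "\<lambda>_. 0" C 0 r] True by (simp add: linear_zero)
next
  case False
  then obtain z a where a: "g z = ereal a"
    using proper by (metis ereal_cases)
  obtain C1 where C1: "C1 \<in> N" "\<And>c. c \<in> C1 \<Longrightarrow> ereal (a - 1) < g (z + c)"
    using lsc[of "a - 1" z] a by auto
  have "ereal ((a - 1) - s * 1) \<le> g (z + s *\<^sub>R c)" if c: "c \<in> C1" and s: "0 \<le> s" for c s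
  proof (cases "s \<le> 1")
    case True
    then have "ereal (a - 1) < g (z + s *\<^sub>R c)"
      using c s by (intro C1 shrink_nhd) auto
    moreover have "ereal ((a - 1) - s * 1) \<le> ereal (a - 1)" using s by simp
    ultimately show ?thesis by (meson less_imp_le order_trans)
  next
    case False
    show ?thesis
    proof (cases "g (z + s *\<^sub>R c)")
      case (real v)
      (* Beyond C1, the point z + c lies on the segment from z to z + s c, and g (z + c) is
         already known to exceed a - 1. *)
      have "z + c = (1 / s) *\<^sub>R (z + s *\<^sub>R c) + (1 - 1 / s) *\<^sub>R z"
        using False by (simp add: algebra_simps)
      then have "g (z + c) \<le> ereal (1 / s) * g (z + s *\<^sub>R c) + ereal (1 - 1 / s) * g z"
        using convex_g[of "1 / s" "z + s *\<^sub>R c" z] False by simp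
      also have "\<dots> = ereal (v / s + (1 - 1 / s) * a)"
        using real a by simp
      finally have "ereal (a - 1) < ereal (v / s + (1 - 1 / s) * a)"
        by (rule less_le_trans[OF C1(2)[OF c]])
      then have "a - 1 < v / s + (1 - 1 / s) * a" by simp
      then have "s * (a - 1) < s * (v / s + (1 - 1 / s) * a)"
        using False by (intro mult_strict_left_mono) auto
      also have "\<dots> = v + s * a - a" using False by (simp add: field_simps)
      finally have "s * (a - 1) < v + s * a - a" .
      then show ?thesis using real by (simp add: algebra_simps)
    qed (use proper in auto)
  qed
  then obtain \<phi>1 where phi1: "linear \<phi>1" "\<And>c. c \<in> C1 \<Longrightarrow> - 1 \<le> \<phi>1 c"
      "\<And>y. ereal (\<phi>1 (y - z) + (a - 1)) \<le> g y"
    using affine_minorant_above_gauge[OF convex_g C1(1), of 1 "a - 1" z] by auto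
  define c1 where "c1 = a - 1 - \<phi>1 z"
  have minor1: "ereal (\<phi>1 y + c1) \<le> g y" for y
    using phi1(3)[of y] linear_diff[OF phi1(1)] by (simp add: c1_def algebra_simps)
  show thesis
  proof (cases "r \<le> \<phi>1 x + c1")
    case True
    then show thesis using that phi1 C1 minor1 by blast
  next
    case False
    define \<rho> where "\<rho> = r - (\<phi>1 x + c1)"
    define u where "u y = g y - ereal (\<phi>1 y + c1)" for y
    have g_eq: "g y = u y + ereal (\<phi>1 y + c1)" for y
      unfolding u_def by (cases "g y") auto
    have u_nonneg: "0 \<le> u y" for y
      using minor1[of y] unfolding u_def by (cases "g y") auto
    have convex_u: "u (t *\<^sub>R y + (1 - t) *\<^sub>R w) \<le> ereal t * u y + ereal (1 - t) * u w"
      if t: "0 < t" "t < 1" for y w t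
    proof -
      let ?v = "t *\<^sub>R y + (1 - t) *\<^sub>R w"
      have aff: "\<phi>1 ?v + c1 = t * (\<phi>1 y + c1) + (1 - t) * (\<phi>1 w + c1)"
        unfolding linear_add[OF phi1(1)] linear_scale[OF phi1(1)] by (simp add: algebra_simps)
      show ?thesis
        using convex_g[OF t, of y w] aff t proper[of y] proper[of w] proper[of ?v] unfolding u_def
        by (cases "g y"; cases "g w"; cases "g ?v") (auto simp: algebra_simps)
    qed
    (* The room between r and r' absorbs the variation of \<phi>1 on a small neighbourhood. *)
    obtain r' where r': "r < r'" "ereal r' < g x"
      using ereal_dense2[OF r] by auto
    obtain C2 where C2: "C2 \<in> N" "\<And>c. c \<in> C2 \<Longrightarrow> ereal r' < g (x + c)"
      using lsc[OF r'(2)] by blast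
    obtain D where D: "D \<in> N" "\<And>d. d \<in> D \<Longrightarrow> \<bar>\<phi>1 d\<bar> \<le> r' - r"
      using bounded_below_imp_small[OF phi1(1) C1(1) phi1(2), of "r' - r"] r'(1) by auto
    have E: "C2 \<inter> D \<in> N" using C2(1) D(1) by (rule Int_nhd)
    have "ereal (\<rho> - s * \<rho>) \<le> u (x + s *\<^sub>R c)" if c: "c \<in> C2 \<inter> D" and s: "0 \<le> s" for c s
    proof (cases "s \<le> 1")
      case True
      then have sc: "s *\<^sub>R c \<in> C2 \<inter> D"
        using c s E by (intro shrink_nhd) auto
      have "ereal (\<rho> - s * \<rho>) \<le> ereal \<rho>"
        using False s by (simp add: \<rho>_def)
      also have "\<dots> \<le> u (x + s *\<^sub>R c)"
        using C2(2)[of "s *\<^sub>R c"] D(2)[of "s *\<^sub>R c"] sc linear_add[OF phi1(1), of x "s *\<^sub>R c"]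
        unfolding u_def \<rho>_def by (cases "g (x + s *\<^sub>R c)") auto
      finally show ?thesis .
    next
      case s1: False
      have "\<rho> - s * \<rho> = (1 - s) * \<rho>" by (simp add: algebra_simps)
      also have "\<dots> \<le> 0"
        using False s1 by (intro mult_nonpos_nonneg) (auto simp: \<rho>_def)
      finally show ?thesis
        using u_nonneg[of "x + s *\<^sub>R c"] by (meson ereal_less_eq(3) order_trans zero_ereal_def ereal_less_eq(4))
    qed
    then obtain \<phi>2 where phi2: "linear \<phi>2" "\<And>c. c \<in> C2 \<inter> D \<Longrightarrow> - \<rho> \<le> \<phi>2 c"
        "\<And>y. ereal (\<phi>2 (y - x) + \<rho>) \<le> u y"
      using affine_minorant_above_gauge[OF convex_u E, of \<rho> \<rho> x] False by (auto simp: \<rho>_def)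
    show thesis
    proof (rule that)
      show "linear (\<lambda>y. \<phi>1 y + \<phi>2 y)"
        using phi1(1) phi2(1) by (rule linear_compose_add)
      show "C1 \<inter> (C2 \<inter> D) \<in> N" using C1(1) E by (rule Int_nhd)
      show "- (1 + \<rho>) \<le> \<phi>1 y + \<phi>2 y" if "y \<in> C1 \<inter> (C2 \<inter> D)" for y
        using phi1(2)[of y] phi2(2)[of y] that by simp
      show "ereal (\<phi>1 y + \<phi>2 y + (c1 + \<rho> - \<phi>2 x)) \<le> g y" for y
        using phi2(3)[of y] linear_diff[OF phi2(1), of y x] unfolding u_def
        by (cases "g y") (auto simp: algebra_simps)
      show "r \<le> \<phi>1 x + \<phi>2 x + (c1 + \<rho> - \<phi>2 x)"
        by (simp add: \<rho>_def)
    qed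
  qed
qed

end

section \<open>Affine minorants on locally convex spaces of classes\<close>

text \<open>
Transfer of the Fenchel-Moreau theorem along a linear surjection \<open>T\<close> from a vector space onto a
space of classes whose operations are known only through \<open>T\<close>. The family \<open>N\<close> of convex sets
containing the preimage of a neighbourhood of zero is a neighbourhood base of the origin for the
pulled-back topology. The
functional found upstairs is small on some member of \<open>N\<close>, and every member of \<open>N\<close> contains the
kernel of \<open>T\<close>; so it factors through \<open>T\<close>, and the factor is continuous.
\<close>
lemma locally_convex_affine_minorant:
  fixes T :: "'v::real_vector \<Rightarrow> 'a rv_class"
  assumes lcs: "locally_convex_space R S \<tau>"
    and range_T: "range T = S" and T_0: "T 0 = const_cls R 0"
    and T_add: "\<And>x y. T (x + y) = add_cls R (T x) (T y)"
    and T_scale: "\<And>a x. T (a *\<^sub>R x) = scale_cls R a (T x)"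
    and convex_g: "convex_fun_cls R S g" and lsc: "lower_semicont \<tau> g"
    and proper: "\<And>Z. Z \<in> S \<Longrightarrow> g Z \<noteq> - \<infinity>"
    and Z: "Z \<in> S" "ereal r < g Z"
  obtains \<psi> c where "\<psi> \<in> topological_dual R \<tau>" "\<And>Y. Y \<in> S \<Longrightarrow> ereal (\<psi> Y + c) \<le> g Y"
    "r \<le> \<psi> Z + c"
proof -
  have top: "topspace \<tau> = S"
    and add_cont: "continuous_map (prod_topology \<tau> \<tau>) \<tau> (\<lambda>(X, Y). add_cls R X Y)"
    and scale_cont: "continuous_map (prod_topology euclideanreal \<tau>) \<tau> (\<lambda>(a, X). scale_cls R a X)"
    and local_base: "\<And>U. openin \<tau> U \<Longrightarrow> const_cls R 0 \<in> U \<Longrightarrow>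
        \<exists>V C. openin \<tau> V \<and> const_cls R 0 \<in> V \<and> V \<subseteq> C \<and> C \<subseteq> U \<and> convex_cls R C"
    using lcs unfolding locally_convex_space_def by auto
  have T_S: "T x \<in> S" for x using range_T by blast
  have surj: "\<exists>x. T x = Y" if "Y \<in> S" for Y using that range_T by blast
  have translate: "continuous_map \<tau> \<tau> (\<lambda>Y. add_cls R Y W)" if "W \<in> S" for W
  proof -
    have "continuous_map \<tau> (prod_topology \<tau> \<tau>) (\<lambda>Y. (Y, W))"
      using that top by (intro continuous_map_pairedI) auto
    from continuous_map_compose[OF this add_cont] show ?thesis by (simp add: o_def)
  qed
  have dilate: "continuous_map \<tau> \<tau> (scale_cls R a)" for a
  proof -
    have "continuous_map \<tau> (prod_topology euclideanreal \<tau>) (\<lambda>Y. (a, Y))"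
      by (intro continuous_map_pairedI) auto
    from continuous_map_compose[OF this scale_cont] show ?thesis by (simp add: o_def)
  qed
  have ray: "continuous_map euclideanreal \<tau> (\<lambda>a. scale_cls R a Y)" if "Y \<in> S" for Y
  proof -
    have "continuous_map euclideanreal (prod_topology euclideanreal \<tau>) (\<lambda>a. (a, Y))"
      using that top by (intro continuous_map_pairedI) auto
    from continuous_map_compose[OF this scale_cont] show ?thesis by (simp add: o_def)
  qed
  define N where "N = {C :: 'v set. convex C \<and>
      (\<exists>W. openin \<tau> W \<and> const_cls R 0 \<in> W \<and> T -` W \<subseteq> C)}"
  have N_I: "C \<in> N" if "convex C" "openin \<tau> W" "const_cls R 0 \<in> W" "T -` W \<subseteq> C" for C W
    using that unfolding N_def by blast
  interpret convex_zero_nhds N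
  proof
    show "convex C" if "C \<in> N" for C using that by (simp add: N_def)
    show "\<exists>t>0. t *\<^sub>R x \<in> C" if C: "C \<in> N" for C x
    proof -
      obtain W where W: "openin \<tau> W" "const_cls R 0 \<in> W" "T -` W \<subseteq> C"
        using C unfolding N_def by blast
      have "open {a. scale_cls R a (T x) \<in> W}"
        using openin_continuous_map_preimage[OF ray[OF T_S] W(1)] by simp
      moreover have "0 \<in> {a. scale_cls R a (T x) \<in> W}"
        using W(2) T_scale[of 0 x] T_0 by simp
      ultimately obtain e where e: "e > 0" "ball 0 e \<subseteq> {a. scale_cls R a (T x) \<in> W}"
        by (meson open_contains_ball)
      have "e / 2 \<in> ball 0 e" using e(1) by simp
      then have "scale_cls R (e / 2) (T x) \<in> W" using e(2) by blast
      then have "(e / 2) *\<^sub>R x \<in> C"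
        using W(3) T_scale by (metis subsetD vimageI)
      then show ?thesis using e(1) half_gt_zero by blast
    qed
    show "C \<inter> D \<in> N" if CD: "C \<in> N" "D \<in> N" for C D
    proof -
      obtain V W where V: "openin \<tau> V" "const_cls R 0 \<in> V" "T -` V \<subseteq> C"
        and W: "openin \<tau> W" "const_cls R 0 \<in> W" "T -` W \<subseteq> D"
        using CD unfolding N_def by blast
      show ?thesis
      proof (rule N_I)
        show "convex (C \<inter> D)" using CD by (auto simp: N_def intro: convex_Int)
        show "openin \<tau> (V \<inter> W)" using V W by (intro openin_Int)
      qed (use V W in auto)
    qed
    show "(\<lambda>x. a *\<^sub>R x) ` C \<in> N" if C: "C \<in> N" and a: "a \<noteq> 0" for C a
    proof -
      obtain W where W: "openin \<tau> W" "const_cls R 0 \<in> W" "T -` W \<subseteq> C"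
        using C unfolding N_def by blast
      show ?thesis
      proof (rule N_I)
        show "convex ((\<lambda>x. a *\<^sub>R x) ` C)"
          using C by (auto simp: N_def intro: convex_scaling)
        show "openin \<tau> {Y \<in> topspace \<tau>. scale_cls R (1 / a) Y \<in> W}"
          using dilate W(1) by (rule openin_continuous_map_preimage)
        show "const_cls R 0 \<in> {Y \<in> topspace \<tau>. scale_cls R (1 / a) Y \<in> W}"
          using W(2) T_scale[of "1 / a" 0] T_0 T_S[of 0] top by simp
        show "T -` {Y \<in> topspace \<tau>. scale_cls R (1 / a) Y \<in> W} \<subseteq> (\<lambda>x. a *\<^sub>R x) ` C"
        proof
          fix x assume "x \<in> T -` {Y \<in> topspace \<tau>. scale_cls R (1 / a) Y \<in> W}"
          then have "(1 / a) *\<^sub>R x \<in> C"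
            using W(3) T_scale[of "1 / a" x] by auto
          moreover have "x = a *\<^sub>R ((1 / a) *\<^sub>R x)" using a by simp
          ultimately show "x \<in> (\<lambda>x. a *\<^sub>R x) ` C" by (rule rev_image_eqI)
        qed
      qed
    qed
  qed
  have "convex (UNIV :: 'v set)" by simp
  then have N_ne: "N \<noteq> {}"
    using N_I[of UNIV S] T_S[of 0] T_0 openin_topspace[of \<tau>] top by auto
  have lsc': "\<exists>C\<in>N. \<forall>c\<in>C. ereal r < g (T (x + c))" if r: "ereal r < g (T x)" for x r
  proof -
    define U where "U = {Y \<in> S. ereal r < g Y}"
    have "closedin \<tau> {Y \<in> topspace \<tau>. g Y \<le> ereal r}"
      using lsc unfolding lower_semicont_def by blast
    then have "openin \<tau> (topspace \<tau> - {Y \<in> topspace \<tau>. g Y \<le> ereal r})"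
      by (intro openin_diff openin_topspace)
    also have "topspace \<tau> - {Y \<in> topspace \<tau>. g Y \<le> ereal r} = U"
      unfolding U_def top by auto
    finally have "openin \<tau> U" .
    then have shifted: "openin \<tau> {Y \<in> topspace \<tau>. add_cls R Y (T x) \<in> U}" (is "openin _ ?U'")
      by (rule openin_continuous_map_preimage[OF translate[OF T_S]])
    have zero: "const_cls R 0 \<in> {Y \<in> topspace \<tau>. add_cls R Y (T x) \<in> U}"
      using T_add[of 0 x] T_0 T_S[of 0] T_S[of x] r top by (simp add: U_def)
    obtain V D where V: "openin \<tau> V" "const_cls R 0 \<in> V" "V \<subseteq> D" "D \<subseteq> ?U'" "convex_cls R D"
      using local_base[OF shifted zero] by (elim exE conjE) (rule that)
    have "convex (T -` D)"
      unfolding convex_alt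
    proof (intro ballI allI impI)
      fix y z t assume "y \<in> T -` D" "z \<in> T -` D" "0 \<le> t \<and> t \<le> (1::real)"
      then show "(1 - t) *\<^sub>R y + t *\<^sub>R z \<in> T -` D"
        using V(5)[unfolded convex_cls_def, rule_format, of "T z" "T y" t]
        by (simp add: add.commute[of "(1 - t) *\<^sub>R y"] T_add T_scale)
    qed
    then have "T -` D \<in> N"
      using V(1,2,3) by (intro N_I) auto
    moreover have "ereal r < g (T (x + c))" if "c \<in> T -` D" for c
      using that V(4) T_add[of c x] by (auto simp: U_def add.commute)
    ultimately show ?thesis by blast
  qed
  obtain z where z: "T z = Z" using surj Z(1) by blast
  have convex_gT: "g (T (t *\<^sub>R x + (1 - t) *\<^sub>R y)) \<le> ereal t * g (T x) + ereal (1 - t) * g (T y)"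
    if "0 < t" "t < 1" for x y t
    using convex_g[unfolded convex_fun_cls_def, rule_format, of "T x" "T y" t] that T_S
    by (simp add: T_add T_scale)
  obtain \<phi> c C k where phi: "linear \<phi>" "C \<in> N" "\<And>y. y \<in> C \<Longrightarrow> - k \<le> \<phi> y"
      "\<And>y. ereal (\<phi> y + c) \<le> g (T y)" "r \<le> \<phi> z + c"
    using Fenchel_Moreau_minorant[of "\<lambda>x. g (T x)" r z, OF convex_gT _ lsc' _ N_ne]
      proper T_S Z(2) z by metis
  note small = bounded_below_imp_small[OF phi(1-3)]
  have ker: "\<phi> x = 0" if x: "T x = T 0" for x
  proof (rule ccontr)
    assume "\<phi> x \<noteq> 0"
    obtain D where D: "D \<in> N" "\<forall>d\<in>D. \<bar>\<phi> d\<bar> \<le> \<bar>\<phi> x\<bar> / 2"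
      using small[of "\<bar>\<phi> x\<bar> / 2"] \<open>\<phi> x \<noteq> 0\<close> by auto
    obtain W where "const_cls R 0 \<in> W" "T -` W \<subseteq> D"
      using D(1) unfolding N_def by blast
    then have "x \<in> D" using x T_0 by auto
    then show False using D(2) \<open>\<phi> x \<noteq> 0\<close> by force
  qed
  have phi_cong: "\<phi> x = \<phi> y" if "T x = T y" for x y
  proof -
    have "T (x - y) = add_cls R (T x) (scale_cls R (- 1) (T y))"
      using T_add[of x "(- 1) *\<^sub>R y"] T_scale[of "- 1" y] by simp
    also have "\<dots> = T (y - y)"
      using T_add[of y "(- 1) *\<^sub>R y"] T_scale[of "- 1" y] that by simp
    finally have "\<phi> (x - y) = 0" by (intro ker) simp
    then show ?thesis using linear_diff[OF phi(1)] by simp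
  qed
  define \<psi> where "\<psi> = restrict (\<lambda>Y. \<phi> (SOME x. T x = Y)) S"
  have psi_T: "\<psi> (T x) = \<phi> x" for x
  proof -
    have "T (SOME y. T y = T x) = T x" by (rule someI[of _ x]) (rule refl)
    from phi_cong[OF this] show ?thesis using T_S by (simp add: \<psi>_def)
  qed
  have "continuous_map \<tau> euclideanreal \<psi>"
    unfolding continuous_map_def
  proof (intro conjI allI impI)
    show "\<psi> \<in> topspace \<tau> \<rightarrow> topspace euclideanreal" by simp
    fix U :: "real set" assume "openin euclideanreal U"
    then have U: "open U" by simp
    show "openin \<tau> {Y \<in> topspace \<tau>. \<psi> Y \<in> U}"
    proof (subst openin_subopen, intro ballI)
      fix Y assume "Y \<in> {Y \<in> topspace \<tau>. \<psi> Y \<in> U}"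
      then obtain y where y: "Y = T y" "\<phi> y \<in> U"
      proof -
        have Y: "Y \<in> S" "\<psi> Y \<in> U" using \<open>Y \<in> _\<close> top by auto
        from surj[OF Y(1)] obtain y where "T y = Y" by blast
        then show thesis using that[of y] Y(2) psi_T[of y] by simp
      qed
      obtain e where e: "e > 0" "ball (\<phi> y) e \<subseteq> U"
        using U y(2) by (meson open_contains_ball)
      obtain D where D: "D \<in> N" "\<forall>d\<in>D. \<bar>\<phi> d\<bar> \<le> e / 2"
        using small[of "e / 2"] e(1) by auto
      obtain W where W: "openin \<tau> W" "const_cls R 0 \<in> W" "T -` W \<subseteq> D"
        using D(1) unfolding N_def by blast
      define G where "G = {Y' \<in> topspace \<tau>. add_cls R Y' (T (- y)) \<in> W}"
      have "openin \<tau> G"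
        unfolding G_def by (rule openin_continuous_map_preimage[OF translate[OF T_S] W(1)])
      moreover have "Y \<in> G"
        using T_add[of y "- y"] T_0 W(2) T_S top unfolding G_def y by simp
      moreover have "G \<subseteq> {Y \<in> topspace \<tau>. \<psi> Y \<in> U}"
      proof
        fix Y' assume Y': "Y' \<in> G"
        then obtain w where w: "Y' = T w"
          using surj top unfolding G_def by blast
        have "w - y \<in> D"
          using Y' T_add[of w "- y"] W(3) unfolding G_def w by auto
        then have "\<bar>\<phi> w - \<phi> y\<bar> < e"
          using D(2) e(1) linear_diff[OF phi(1), of w y] by force
        then have "\<phi> w \<in> U"
          using e(2) by (auto simp: dist_real_def abs_minus_commute)
        then show "Y' \<in> {Y \<in> topspace \<tau>. \<psi> Y \<in> U}"
          using T_S top by (simp add: w psi_T)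
      qed
      ultimately show "\<exists>G. openin \<tau> G \<and> Y \<in> G \<and> G \<subseteq> {Y \<in> topspace \<tau>. \<psi> Y \<in> U}" by blast
    qed
  qed
  moreover have "\<psi> (add_cls R X Y) = \<psi> X + \<psi> Y" if XY: "X \<in> S" "Y \<in> S" for X Y
  proof -
    obtain x y where "X = T x" "Y = T y" using surj[OF XY(1)] surj[OF XY(2)] by blast
    then show ?thesis
      using psi_T[of "x + y"] unfolding T_add by (simp add: psi_T linear_add[OF phi(1)])
  qed
  moreover have "\<psi> (scale_cls R a X) = a * \<psi> X" if "X \<in> S" for a X
  proof -
    obtain x where "X = T x" using surj[OF \<open>X \<in> S\<close>] by blast
    then show ?thesis
      using psi_T[of "a *\<^sub>R x"] unfolding T_scale by (simp add: psi_T linear_scale[OF phi(1)])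
  qed
  ultimately have "\<psi> \<in> topological_dual R \<tau>"
    unfolding topological_dual_def top by (simp add: \<psi>_def)
  moreover have "ereal (\<psi> Y + c) \<le> g Y" if "Y \<in> S" for Y
  proof -
    obtain y where "Y = T y" using surj[OF \<open>Y \<in> S\<close>] by blast
    then show ?thesis using phi(4)[of y] psi_T[of y] by simp
  qed
  moreover have "r \<le> \<psi> Z + c"
    using phi(5) psi_T[of z] z by simp
  ultimately show thesis by (rule that)
qed


section \<open>Finite signed measures and dominating probabilities\<close>

definition sigma_additive :: "'a measure \<Rightarrow> ('a set \<Rightarrow> real) \<Rightarrow> bool" where
  "sigma_additive M \<mu> \<longleftrightarrow> (\<forall>A. range A \<subseteq> sets M \<longrightarrow> disjoint_family A \<longrightarrow>
     (\<lambda>n::nat. \<mu> (A n)) sums \<mu> (\<Union>n. A n))"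

lemma ca_eq: "ca M = extensional (sets M) \<inter> Collect (sigma_additive M)"
  by (auto simp: ca_def sigma_additive_def)

lemma sigma_additive_uminus: "sigma_additive M \<mu> \<Longrightarrow> sigma_additive M (\<lambda>A. - \<mu> A)"
  unfolding sigma_additive_def by (auto intro: sums_minus)

lemma sets_pos_part [simp, measurable_cong]: "sets (pos_part M \<mu>) = sets M"
  and space_pos_part [simp]: "space (pos_part M \<mu>) = space M"
  by (simp_all add: pos_part_def space_measure_of_conv)

lemma emeasure_pos_part_eq:
  "sigma_additive M \<mu> \<Longrightarrow> A \<in> sets M \<Longrightarrow> emeasure (pos_part M \<mu>) A = pos_var M \<mu> A"
  by (rule emeasure_pos_part) (auto simp: sigma_additive_def)

lemma sigma_additive_empty: "sigma_additive M \<mu> \<Longrightarrow> \<mu> {} = 0"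
proof -
  assume "sigma_additive M \<mu>"
  then have "(\<lambda>n::nat. \<mu> {}) sums \<mu> {}"
    unfolding sigma_additive_def by (auto dest: spec[of _ "\<lambda>_. {}"] simp: disjoint_family_on_def)
  then have "(\<lambda>n::nat. \<mu> {}) \<longlonglongrightarrow> 0"
    by (auto dest: sums_summable summable_LIMSEQ_zero)
  then show ?thesis by (simp add: LIMSEQ_const_iff)
qed

lemma sigma_additive_Diff:
  assumes "sigma_additive M \<mu>" "A \<in> sets M" "B \<in> sets M" "B \<subseteq> A"
  shows "\<mu> (A - B) = \<mu> A - \<mu> B"
proof -
  have "range (binaryset B (A - B)) \<subseteq> sets M" "disjoint_family (binaryset B (A - B))"
    using assms by (auto simp: range_binaryset_eq disjoint_family_on_def binaryset_def)
  then have "(\<lambda>n. \<mu> (binaryset B (A - B) n)) sums \<mu> (\<Union>n. binaryset B (A - B) n)"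
    using assms(1) unfolding sigma_additive_def by blast
  also have "(\<Union>n. binaryset B (A - B) n) = A"
    using assms(4) by (auto simp: UN_binaryset_eq)
  finally have "(\<lambda>n. \<mu> (binaryset B (A - B) n)) sums \<mu> A" .
  moreover have "(\<lambda>n. \<mu> (binaryset B (A - B) n)) sums (\<mu> B + \<mu> (A - B))"
    by (rule binaryset_sums) (rule sigma_additive_empty[OF assms(1)])
  ultimately show ?thesis
    using sums_unique2 by fastforce
qed

text \<open>
If the positive variation of \<open>E\<close> is infinite, \<open>E\<close> contains a set \<open>A\<close> with \<open>\<mu> A > \<bar>\<mu> E\<bar> + 1\<close>, so
both \<open>A\<close> and \<open>E - A\<close> have measure of modulus at least 1, and one of them has again infinite positive
variation. Iterating in that part, the discarded parts are disjoint sets of measure bounded away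
from zero, which contradicts the convergence required by countable additivity.
\<close>
lemma pos_var_finite:
  assumes \<mu>: "sigma_additive M \<mu>"
  shows "pos_var M \<mu> (space M) < \<infinity>"
proof (rule ccontr)
  assume "\<not> ?thesis"
  then have top: "pos_var M \<mu> (space M) = \<infinity>"
    by (metis infinity_ennreal_def less_top)
  define I where "I = {E \<in> sets M. pos_var M \<mu> E = \<infinity>}"
  have step: "\<exists>F. F \<in> I \<and> F \<subseteq> E \<and> 1 \<le> \<bar>\<mu> (E - F)\<bar>" if E: "E \<in> I" for E
  proof -
    have "ennreal (\<bar>\<mu> E\<bar> + 1) < pos_var M \<mu> E"
      using E by (simp add: I_def)
    then obtain A where A: "A \<in> sets M" "A \<subseteq> E" "ennreal (\<bar>\<mu> E\<bar> + 1) < ennreal (\<mu> A)"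
      unfolding pos_var_def less_SUP_iff by auto
    have large: "\<bar>\<mu> E\<bar> + 1 < \<mu> A"
      using A(3) by (subst (asm) ennreal_less_iff) auto
    have EM: "E \<in> sets M" using E by (simp add: I_def)
    have diff: "\<mu> (E - A) = \<mu> E - \<mu> A"
      using \<mu> EM A by (intro sigma_additive_Diff)
    have "pos_var M \<mu> A + pos_var M \<mu> (E - A) = pos_var M \<mu> E"
      using plus_emeasure[of A "pos_part M \<mu>" "E - A"] A EM
      by (simp add: emeasure_pos_part_eq[OF \<mu>] Un_absorb1)
    then consider "A \<in> I" | "E - A \<in> I"
      using E A by (auto simp: I_def ennreal_add_eq_top)
    then show ?thesis
    proof cases
      case 1
      then show ?thesis using A large diff by (intro exI[of _ A]) auto
    next
      case 2
      have "E - (E - A) = A" using A by auto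
      with 2 show ?thesis using large by (intro exI[of _ "E - A"]) auto
    qed
  qed
  obtain E where E: "\<And>n. E n \<in> I" "\<And>n. E (Suc n) \<subseteq> E n \<and> 1 \<le> \<bar>\<mu> (E n - E (Suc n))\<bar>"
  proof (rule exE[OF dependent_nat_choice[of "\<lambda>_ E. E \<in> I" "\<lambda>_ E F. F \<subseteq> E \<and> 1 \<le> \<bar>\<mu> (E - F)\<bar>"]])
    show "\<exists>E. E \<in> I" using top by (auto simp: I_def)
    show "\<exists>F. F \<in> I \<and> F \<subseteq> E \<and> 1 \<le> \<bar>\<mu> (E - F)\<bar>" if "E \<in> I" for E and n :: nat
      using step[OF that] .
  qed blast
  have "decseq E"
    using E(2) by (intro decseq_SucI) blast
  define A where "A n = E n - E (Suc n)" for n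
  have "A m \<inter> A n = {}" if "m < n" for m n
    using decseqD[OF \<open>decseq E\<close>, of "Suc m" n] that unfolding A_def by auto
  then have "disjoint_family A"
    unfolding disjoint_family_on_def by (metis Int_commute linorder_neqE_nat)
  moreover have "range A \<subseteq> sets M"
    using E(1) unfolding A_def I_def by auto
  ultimately have "(\<lambda>n. \<mu> (A n)) sums \<mu> (\<Union>n. A n)"
    using \<mu> unfolding sigma_additive_def by blast
  then have "(\<lambda>n. \<mu> (A n)) \<longlonglongrightarrow> 0"
    by (auto dest: sums_summable summable_LIMSEQ_zero)
  then obtain n where "\<bar>\<mu> (A n)\<bar> < 1"
    using LIMSEQ_D[of "\<lambda>n. \<mu> (A n)" 0 1] by force
  with E(2)[of n] show False unfolding A_def by simp
qed

lemma total_variation_mono: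
  assumes "sigma_additive M \<mu>" "A \<in> sets M" "B \<in> sets M" "A \<subseteq> B"
  shows "total_variation M \<mu> A \<le> total_variation M \<mu> B"
  using assms unfolding total_variation_def neg_part_def by (intro add_mono emeasure_mono) auto

lemma restrict_measure_in_ca:
  assumes "finite_measure Q" "sets Q = sets M"
  shows "restrict (measure Q) (sets M) \<in> ca M"
proof -
  interpret finite_measure Q by fact
  show ?thesis
    unfolding ca_def
  proof (intro CollectI conjI allI impI restrict_extensional)
    fix A :: "nat \<Rightarrow> 'a set"
    assume A: "range A \<subseteq> sets M" "disjoint_family A"
    then have "(\<lambda>n. measure Q (A n)) sums measure Q (\<Union>n. A n)"
      using assms(2) by (intro finite_measure_UNION) auto
    then show "(\<lambda>n. restrict (measure Q) (sets M) (A n)) sums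
        restrict (measure Q) (sets M) (\<Union>n. A n)"
      using A by (simp add: range_subsetD sets.countable_UN)
  qed
qed

lemma total_variation_measure_eq_0_iff:
  assumes "finite_measure Q" "sets Q = sets M" "A \<in> sets M"
  shows "total_variation M (restrict (measure Q) (sets M)) A = 0 \<longleftrightarrow> emeasure Q A = 0"
proof -
  interpret finite_measure Q by fact
  let ?\<mu> = "restrict (measure Q) (sets M)"
  have s: "sigma_additive M ?\<mu>"
    using restrict_measure_in_ca[OF assms(1,2)] by (simp add: ca_eq)
  have "pos_var M ?\<mu> A = emeasure Q A"
    unfolding pos_var_def
  proof (rule antisym)
    show "(SUP B\<in>{B \<in> sets M. B \<subseteq> A}. ennreal (?\<mu> B)) \<le> emeasure Q A"
      using assms by (auto intro!: SUP_least emeasure_mono simp: emeasure_eq_measure[symmetric])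
    show "emeasure Q A \<le> (SUP B\<in>{B \<in> sets M. B \<subseteq> A}. ennreal (?\<mu> B))"
      using assms by (auto intro!: SUP_upper2[of A] simp: emeasure_eq_measure)
  qed
  moreover have "pos_var M (\<lambda>A. - ?\<mu> A) A = 0"
    unfolding pos_var_def using assms by (auto simp: bot_ennreal SUP_eq_iff ennreal_neg intro!: SUP_eqI)
  ultimately show ?thesis
    unfolding total_variation_def neg_part_def
    using emeasure_pos_part_eq[OF s assms(3)]
      emeasure_pos_part_eq[OF sigma_additive_uminus[OF s] assms(3)] by simp
qed

text \<open>
For probability measures, membership in \<open>ca_c\<close> is the plain condition of vanishing on polar events;
this is how \<^const>\<open>prob_c\<close> is used from here on.
\<close>
lemma mem_prob_c_iff:
  "Q \<in> prob_c M \<P> \<longleftrightarrow>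
     prob_space Q \<and> sets Q = sets M \<and> (\<forall>A. polar M \<P> A \<longrightarrow> emeasure Q A = 0)"
proof -
  have "restrict (measure Q) (sets M) \<in> ca_c M \<P> \<longleftrightarrow> (\<forall>A. polar M \<P> A \<longrightarrow> emeasure Q A = 0)"
    if "prob_space Q" "sets Q = sets M"
  proof -
    have "finite_measure Q"
      using that(1) by (simp add: prob_space_def)
    then show ?thesis
      using that restrict_measure_in_ca[of Q M] total_variation_measure_eq_0_iff[of Q M]
      unfolding ca_c_def polar_def by blast
  qed
  then show ?thesis unfolding prob_c_def by blast
qed

lemma subset_prob_c:
  assumes "\<forall>P\<in>\<P>. prob_space P \<and> sets P = sets M"
  shows "\<P> \<subseteq> prob_c M \<P>"
proof
  fix P assume P: "P \<in> \<P>"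
  have "emeasure P A = 0" if "polar M \<P> A" for A
    using that SUP_upper[OF P, of "\<lambda>P. emeasure P A"] unfolding polar_def upper_prob_def by simp
  then show "P \<in> prob_c M \<P>"
    using assms P by (simp add: mem_prob_c_iff)
qed

lemma ca_Q_subset_ca_c: "Q \<in> prob_c M \<P> \<Longrightarrow> ca_Q M Q \<subseteq> ca_c M \<P>"
  unfolding mem_prob_c_iff ca_Q_def ca_c_def polar_def by auto

text \<open>
The dominating probability is the total variation of \<open>\<mu>\<close> divided by its total mass. For \<open>\<mu> = 0\<close>,
where this is impossible, any member of \<^term>\<open>prob_c M \<P>\<close> will do.
\<close>
lemma ca_c_dominated_by_prob:
  assumes \<mu>: "\<mu> \<in> ca_c M \<P>" and ne: "prob_c M \<P> \<noteq> {}"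
  obtains Q where "Q \<in> prob_c M \<P>" "\<mu> \<in> ca_Q M Q"
proof -
  have s: "sigma_additive M \<mu>" and ca: "\<mu> \<in> ca M"
    using \<mu> by (auto simp: ca_c_def ca_eq)
  define c where "c = total_variation M \<mu> (space M)"
  show thesis
  proof (cases "c = 0")
    case True
    obtain Q where Q: "Q \<in> prob_c M \<P>" using ne by blast
    have "total_variation M \<mu> A = 0" if "A \<in> sets M" for A
      using total_variation_mono[OF s that sets.top] sets.sets_into_space[OF that] True
      unfolding c_def by simp
    then have "\<mu> \<in> ca_Q M Q" using ca unfolding ca_Q_def by simp
    with Q show thesis by (rule that)
  next
    case False
    have cfin: "c < \<infinity>"
      unfolding c_def total_variation_def neg_part_def
      using pos_var_finite[OF s] pos_var_finite[OF sigma_additive_uminus[OF s]]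
      by (simp add: emeasure_pos_part_eq s sigma_additive_uminus)
    define Q where "Q = measure_of (space M) (sets M) (\<lambda>A. total_variation M \<mu> A / c)"
    have sets_Q: "sets Q = sets M" and space_Q: "space Q = space M"
      by (simp_all add: Q_def space_measure_of_conv)
    have Q: "emeasure Q A = total_variation M \<mu> A / c" if "A \<in> sets M" for A
      unfolding Q_def
    proof (rule emeasure_measure_of_sigma[OF sets.sigma_algebra_axioms _ _ that])
      show "positive (sets M) (\<lambda>A. total_variation M \<mu> A / c)"
        by (simp add: positive_def total_variation_def)
      show "countably_additive (sets M) (\<lambda>A. total_variation M \<mu> A / c)"
        unfolding countably_additive_def total_variation_def neg_part_def
        by (auto simp: ennreal_suminf_divide[symmetric] suminf_add[symmetric] suminf_emeasure)
    qed
    have "prob_space Q"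
      using Q[OF sets.top] cfin False by (intro prob_spaceI) (simp add: space_Q c_def)
    then have "Q \<in> prob_c M \<P>"
      using \<mu> Q sets_Q unfolding mem_prob_c_iff ca_c_def polar_def by simp
    moreover have "\<mu> \<in> ca_Q M Q"
      using ca Q cfin unfolding ca_Q_def by (simp add: ennreal_divide_eq_0_iff less_top)
    ultimately show thesis by (rule that)
  qed
qed

lemma signed_integral_cong_AE:
  assumes "\<mu> \<in> ca_Q M Q" "sets Q = sets M" "x \<in> borel_measurable M" "y \<in> borel_measurable M"
    and "AE \<omega> in Q. x \<omega> = y \<omega>"
  shows "signed_integral M \<mu> x = signed_integral M \<mu> y"
proof -
  note [measurable] = assms(3,4)
  have space: "space Q = space M" using assms(2) by (rule sets_eq_imp_space_eq)
  have N: "{\<omega> \<in> space M. x \<omega> \<noteq> y \<omega>} \<in> sets M" by measurable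
  have "emeasure Q {\<omega> \<in> space M. x \<omega> \<noteq> y \<omega>} = 0"
    using assms(5) N by (subst (asm) AE_iff_measurable[OF _ refl]) (auto simp: assms(2) space)
  then have null: "total_variation M \<mu> {\<omega> \<in> space M. x \<omega> \<noteq> y \<omega>} = 0"
    using assms(1) N unfolding ca_Q_def by blast
  have "AE \<omega> in pos_part M \<nu>. x \<omega> = y \<omega>"
    if "emeasure (pos_part M \<nu>) {\<omega> \<in> space M. x \<omega> \<noteq> y \<omega>} = 0" for \<nu>
    using that N by (intro AE_I[of _ _ "{\<omega> \<in> space M. x \<omega> \<noteq> y \<omega>}"]) auto
  then have "integral\<^sup>L (pos_part M \<nu>) x = integral\<^sup>L (pos_part M \<nu>) y"
    if "emeasure (pos_part M \<nu>) {\<omega> \<in> space M. x \<omega> \<noteq> y \<omega>} = 0" for \<nu>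
    using that by (intro integral_cong_AE) auto
  then show ?thesis
    using null unfolding total_variation_def signed_integral_def neg_part_def by simp
qed

section \<open>Random variables and their classes\<close>

text \<open>
The representatives of the classes in \<open>\<X>\<close> form a subspace of the vector space of all real functions
on \<open>\<Omega>\<close> under pointwise operations.
\<close>
instantiation "fun" :: (type, real_vector) real_vector
begin

definition scaleR_fun_def: "a *\<^sub>R f = (\<lambda>x. a *\<^sub>R f x)"

instance
  by standard (simp_all add: scaleR_fun_def fun_eq_iff scaleR_add_left scaleR_add_right)

end

text \<open>
Composing with such a projection extends maps from a subspace to the whole vector space, so that
vector spaces can be represented by types instead of carrier sets.
\<close>
lemma projection_onto_subspace:
  assumes "subspace (V :: 'v::real_vector set)"
  obtains \<pi> where "linear \<pi>" "range \<pi> = V" "\<And>v. v \<in> V \<Longrightarrow> \<pi> v = v"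
proof -
  obtain \<pi> :: "'v \<Rightarrow> 'v" where \<pi>: "\<pi> ` UNIV \<subseteq> V" "linear \<pi>" "\<forall>v\<in>V. \<pi> (id v) = v"
    using linear_exists_left_inverse_on[OF linear_id assms] by auto
  then have "V \<subseteq> range \<pi>" by (metis id_apply rangeI subsetI)
  with \<pi> show thesis by (intro that[of \<pi>]) auto
qed

lemma polar_Un:
  assumes "\<forall>P\<in>\<P>. sets P = sets M" "polar M \<P> A" "polar M \<P> B"
  shows "polar M \<P> (A \<union> B)"
proof -
  have null: "A \<in> sets M" "B \<in> sets M" "\<And>P. P \<in> \<P> \<Longrightarrow> emeasure P A = 0" "\<And>P. P \<in> \<P> \<Longrightarrow> emeasure P B = 0"
    using assms(2,3) by (auto simp: polar_def upper_prob_def SUP_eq_iff simp flip: bot_ennreal)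
  have "emeasure P (A \<union> B) \<le> 0" if P: "P \<in> \<P>" for P
    using emeasure_subadditive[of A P B] null P assms(1) by simp
  then have "(SUP P\<in>\<P>. emeasure P (A \<union> B)) \<le> 0"
    by (intro SUP_least)
  then show ?thesis
    using null(1,2) by (simp add: polar_def upper_prob_def)
qed

lemma equiv_qs_eq:
  assumes "\<forall>P\<in>\<P>. sets P = sets M"
  shows "equiv (borel_measurable M) (qs_eq M \<P>)"
proof (rule equivI)
  have "polar M \<P> {}"
    by (simp add: polar_def upper_prob_def SUP_eq_iff flip: bot_ennreal)
  then show "refl_on (borel_measurable M) (qs_eq M \<P>)"
    by (auto simp: refl_on_def qs_eq_def)
  show "qs_eq M \<P> \<subseteq> borel_measurable M \<times> borel_measurable M"
    by (auto simp: qs_eq_def)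
  show "sym (qs_eq M \<P>)"
    by (rule symI) (force simp: qs_eq_def)
  show "trans (qs_eq M \<P>)"
  proof (rule transI)
    fix x y z assume "(x, y) \<in> qs_eq M \<P>" "(y, z) \<in> qs_eq M \<P>"
    then obtain A B where meas: "x \<in> borel_measurable M" "z \<in> borel_measurable M"
      and polar: "polar M \<P> A" "polar M \<P> B" and eq: "\<forall>\<omega>\<in>space M - A. x \<omega> = y \<omega>" "\<forall>\<omega>\<in>space M - B. y \<omega> = z \<omega>"
      unfolding qs_eq_def by blast
    have "\<forall>\<omega>\<in>space M - (A \<union> B). x \<omega> = z \<omega>" using eq by simp
    then show "(x, z) \<in> qs_eq M \<P>"
      using meas polar_Un[OF assms polar] unfolding qs_eq_def by blast
  qed
qed

lemma equiv_as_eq: "equiv (borel_measurable Q) (as_eq Q)"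
proof (rule equivI)
  show "refl_on (borel_measurable Q) (as_eq Q)"
    by (auto simp: refl_on_def as_eq_def)
  show "as_eq Q \<subseteq> borel_measurable Q \<times> borel_measurable Q"
    by (auto simp: as_eq_def)
  show "sym (as_eq Q)"
    by (rule symI) (auto simp: as_eq_def elim: AE_mp)
  show "trans (as_eq Q)"
    by (rule transI) (auto simp: as_eq_def elim: AE_mp)
qed

lemma borel_measurable_prob_c:
  "Q \<in> prob_c M \<P> \<Longrightarrow> (borel_measurable Q :: ('a \<Rightarrow> real) set) = borel_measurable M"
  unfolding mem_prob_c_iff by (auto intro: measurable_cong_sets)

text \<open>
Because \<open>Q\<close> does not charge polar events, \<open>j_Q\<close> merely coarsens the classes.
\<close>
lemma qs_eq_subset_as_eq:
  assumes "Q \<in> prob_c M \<P>"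
  shows "qs_eq M \<P> \<subseteq> as_eq Q"
proof (clarify)
  fix x y assume xy: "(x, y) \<in> qs_eq M \<P>"
  then obtain N where N: "polar M \<P> N" "\<forall>\<omega>\<in>space M - N. x \<omega> = y \<omega>"
    unfolding qs_eq_def by blast
  have Q: "sets Q = sets M" "space Q = space M" "emeasure Q N = 0" "N \<in> sets M"
    using assms N(1) unfolding mem_prob_c_iff by (auto simp: polar_def dest: sets_eq_imp_space_eq)
  have "AE \<omega> in Q. x \<omega> = y \<omega>"
    using N(2) Q by (intro AE_I[of _ _ N]) auto
  then show "(x, y) \<in> as_eq Q"
    using xy borel_measurable_prob_c[OF assms] by (simp add: as_eq_def qs_eq_def)
qed

lemma add_cls_as_eq:
  assumes [measurable]: "x \<in> borel_measurable Q" "y \<in> borel_measurable Q"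
  shows "add_cls (as_eq Q) (as_eq Q `` {x}) (as_eq Q `` {y}) = as_eq Q `` {x + y}"
proof -
  have "as_eq Q `` {\<lambda>\<omega>. x' \<omega> + y' \<omega>} = as_eq Q `` {x + y}"
    if "(x, x') \<in> as_eq Q" "(y, y') \<in> as_eq Q" for x' y'
  proof (rule equiv_class_eq[OF equiv_as_eq])
    have "AE \<omega> in Q. x \<omega> = x' \<omega>" "AE \<omega> in Q. y \<omega> = y' \<omega>"
      and [measurable]: "x' \<in> borel_measurable Q" "y' \<in> borel_measurable Q"
      using that by (simp_all add: as_eq_def)
    from this(1,2) have "AE \<omega> in Q. x' \<omega> + y' \<omega> = x \<omega> + y \<omega>"
      by eventually_elim simp
    then show "(\<lambda>\<omega>. x' \<omega> + y' \<omega>, x + y) \<in> as_eq Q"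
      unfolding as_eq_def plus_fun_def by simp
  qed
  moreover have "(x, x) \<in> as_eq Q" "(y, y) \<in> as_eq Q"
    using assms by (simp_all add: as_eq_def)
  ultimately show ?thesis
    unfolding add_cls_def by blast
qed

lemma scale_cls_as_eq:
  assumes [measurable]: "x \<in> borel_measurable Q"
  shows "scale_cls (as_eq Q) a (as_eq Q `` {x}) = as_eq Q `` {a *\<^sub>R x}"
proof -
  have "as_eq Q `` {\<lambda>\<omega>. a * x' \<omega>} = as_eq Q `` {a *\<^sub>R x}" if "(x, x') \<in> as_eq Q" for x'
  proof (rule equiv_class_eq[OF equiv_as_eq])
    have "AE \<omega> in Q. x \<omega> = x' \<omega>" and [measurable]: "x' \<in> borel_measurable Q"
      using that by (simp_all add: as_eq_def)
    from this(1) have "AE \<omega> in Q. a * x' \<omega> = a * x \<omega>"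
      by eventually_elim simp
    then show "(\<lambda>\<omega>. a * x' \<omega>, a *\<^sub>R x) \<in> as_eq Q"
      unfolding as_eq_def scaleR_fun_def by simp
  qed
  moreover have "(x, x) \<in> as_eq Q"
    using assms by (simp add: as_eq_def)
  ultimately show ?thesis
    unfolding scale_cls_def by blast
qed

section \<open>Dual representations\<close>

lemma ereal_minus_le_swap: "ereal i - a \<le> b \<longleftrightarrow> ereal i - b \<le> a"
  by (cases a; cases b) (auto simp: algebra_simps)

locale linear_space_of_classes =
  fixes M :: "'a measure" and \<P> :: "'a measure set" and \<X> :: "'a rv_class set"
  assumes nonempty: "\<P> \<noteq> {}"
    and prob: "\<forall>P\<in>\<P>. prob_space P \<and> sets P = sets M"
    and subset_L0: "\<X> \<subseteq> L0_c M \<P>"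
    and linear_space: "linear_space (qs_eq M \<P>) \<X>"
begin

lemma equiv_qs: "equiv (borel_measurable M) (qs_eq M \<P>)"
  using prob by (intro equiv_qs_eq) auto

lemma prob_c_nonempty: "prob_c M \<P> \<noteq> {}"
  using nonempty subset_prob_c[OF prob] by blast

lemma class_eq:
  assumes "X \<in> \<X>" "x \<in> X"
  shows "x \<in> borel_measurable M" "X = qs_eq M \<P> `` {x}"
proof -
  obtain y where y: "X = qs_eq M \<P> `` {y}"
    using assms(1) subset_L0 unfolding L0_c_def by (auto elim: quotientE)
  then have "(y, x) \<in> qs_eq M \<P>" using assms(2) by simp
  then show "x \<in> borel_measurable M" "X = qs_eq M \<P> `` {x}"
    using equiv_class_eq[OF equiv_qs] by (auto simp: y qs_eq_def)
qed

lemma some_rep: "X \<in> \<X> \<Longrightarrow> (SOME x. x \<in> X) \<in> X"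
  using subset_L0 in_quotient_imp_non_empty[OF equiv_qs, of X] unfolding L0_c_def
  by (auto simp: some_in_eq)

lemma j_map_eq:
  assumes Q: "Q \<in> prob_c M \<P>" and X: "X \<in> \<X>" "x \<in> X"
  shows "j_map Q X = as_eq Q `` {x}"
proof -
  have "as_eq Q `` {y} = as_eq Q `` {x}" if "y \<in> X" for y
  proof (rule equiv_class_eq[OF equiv_as_eq])
    have "(y, x) \<in> qs_eq M \<P>"
      using X(2) class_eq(2)[OF X(1) that] by blast
    then show "(y, x) \<in> as_eq Q" using qs_eq_subset_as_eq[OF Q] by blast
  qed
  then show ?thesis
    using X(2) unfolding j_map_def by blast
qed

text \<open>
Integration against \<open>\<mu> \<in> ca_Q M Q\<close> factors through \<open>j_Q\<close>: both sides evaluate the integral on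
representatives that agree \<open>Q\<close>-almost surely.
\<close>
lemma cls_integral_j_map:
  assumes Q: "Q \<in> prob_c M \<P>" and \<mu>: "\<mu> \<in> ca_Q M Q" and X: "X \<in> \<X>"
  shows "cls_integral M \<mu> (j_map Q X) = cls_integral M \<mu> X"
proof -
  define x where "x = (SOME x. x \<in> X)"
  have x: "x \<in> X" unfolding x_def using X by (rule some_rep)
  have xM: "x \<in> borel_measurable M" using class_eq(1)[OF X x] .
  have j: "j_map Q X = as_eq Q `` {x}" using Q X x by (rule j_map_eq)
  define y where "y = (SOME y. y \<in> as_eq Q `` {x})"
  have "x \<in> as_eq Q `` {x}"
    using xM borel_measurable_prob_c[OF Q] by (simp add: as_eq_def)
  then have "y \<in> as_eq Q `` {x}"
    unfolding y_def by (rule someI[of "\<lambda>y. y \<in> _"])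
  then have "y \<in> borel_measurable M" "AE \<omega> in Q. x \<omega> = y \<omega>"
    using borel_measurable_prob_c[OF Q] by (auto simp: as_eq_def)
  then have "signed_integral M \<mu> x = signed_integral M \<mu> y"
    using \<mu> xM Q unfolding mem_prob_c_iff by (intro signed_integral_cong_AE[of _ M Q]) auto
  then show ?thesis
    unfolding cls_integral_def j by (simp add: x_def y_def)
qed

lemma cls_integral_cong_j_map:
  assumes "Q \<in> prob_c M \<P>" "\<mu> \<in> ca_Q_on M \<P> Q \<X>" "X \<in> \<X>" "Y \<in> \<X>" "j_map Q X = j_map Q Y"
  shows "cls_integral M \<mu> X = cls_integral M \<mu> Y"
  using assms cls_integral_j_map[of Q \<mu> X] cls_integral_j_map[of Q \<mu> Y]
  by (simp add: ca_Q_on_def)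

lemma ca_c_on_eq_UN: "ca_c_on M \<P> \<X> = (\<Union>Q\<in>prob_c M \<P>. ca_Q_on M \<P> Q \<X>)"
proof
  show "ca_c_on M \<P> \<X> \<subseteq> (\<Union>Q\<in>prob_c M \<P>. ca_Q_on M \<P> Q \<X>)"
  proof
    fix \<mu> assume \<mu>: "\<mu> \<in> ca_c_on M \<P> \<X>"
    then have "\<mu> \<in> ca_c M \<P>" by (simp add: ca_c_on_def)
    then obtain Q where "Q \<in> prob_c M \<P>" "\<mu> \<in> ca_Q M Q"
      using ca_c_dominated_by_prob[OF _ prob_c_nonempty] by blast
    with \<mu> show "\<mu> \<in> (\<Union>Q\<in>prob_c M \<P>. ca_Q_on M \<P> Q \<X>)"
      by (auto simp: ca_Q_on_def)
  qed
qed (auto simp: ca_Q_on_def)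

text \<open>
The defining property of the conjugate, in a form in which no undefined differences of infinities
occur: \<open>g\<close> and \<open>a\<close> may be infinite, while the integral is always real.
\<close>
lemma dual_fun_le_iff:
  "dual_fun M \<X> g \<mu> \<le> a \<longleftrightarrow> (\<forall>X\<in>\<X>. ereal (cls_integral M \<mu> X) - a \<le> g X)"
  unfolding dual_fun_def SUP_le_iff by (simp add: ereal_minus_le_swap)

text \<open>
The reason why every supremum of affine minorants is a dual representation.
\<close>
lemma minorant_le_f_D:
  assumes "\<mu> \<in> ca_c_on M \<P> \<X>" "\<And>Y. Y \<in> \<X> \<Longrightarrow> ereal (cls_integral M \<mu> Y) - a \<le> f Y"
  shows "ereal (cls_integral M \<mu> X) - a \<le> f_D M \<P> \<X> f X"
proof -
  have "dual_fun M \<X> f \<mu> \<le> a"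
    using assms(2) by (simp add: dual_fun_le_iff)
  then show ?thesis
    unfolding f_D_def using assms(1) by (intro SUP_upper2[of \<mu>] ereal_minus_mono) auto
qed

lemma f_D_le: "X \<in> \<X> \<Longrightarrow> f_D M \<P> \<X> f X \<le> f X"
  unfolding f_D_def using dual_fun_le_iff[of f] by (intro SUP_least) blast

lemma dual_rep_iff_f_D:
  "dual_rep M \<X> (ca_c_on M \<P> \<X>) f \<longleftrightarrow> (\<forall>X\<in>\<X>. f X = f_D M \<P> \<X> f X)"
proof
  assume "dual_rep M \<X> (ca_c_on M \<P> \<X>) f"
  then obtain h where h: "\<And>X. X \<in> \<X> \<Longrightarrow>
      f X = (SUP \<mu>\<in>ca_c_on M \<P> \<X>. ereal (cls_integral M \<mu> X) - h \<mu>)"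
    unfolding dual_rep_def by blast
  show "\<forall>X\<in>\<X>. f X = f_D M \<P> \<X> f X"
  proof (intro ballI antisym f_D_le)
    fix X assume "X \<in> \<X>"
    then have "f X = (SUP \<mu>\<in>ca_c_on M \<P> \<X>. ereal (cls_integral M \<mu> X) - h \<mu>)"
      by (rule h)
    also have "\<dots> \<le> f_D M \<P> \<X> f X"
    proof (intro SUP_least minorant_le_f_D)
      fix \<mu> Y assume "\<mu> \<in> ca_c_on M \<P> \<X>" "Y \<in> \<X>"
      then show "ereal (cls_integral M \<mu> Y) - h \<mu> \<le> f Y"
        by (subst h) (auto intro: SUP_upper)
    qed
    finally show "f X \<le> f_D M \<P> \<X> f X" .
  qed
next
  assume "\<forall>X\<in>\<X>. f X = f_D M \<P> \<X> f X"
  then show "dual_rep M \<X> (ca_c_on M \<P> \<X>) f"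
    unfolding dual_rep_def f_D_def by (intro exI[of _ "dual_fun M \<X> f"]) blast
qed

lemma dual_repI: "(\<And>X. X \<in> \<X> \<Longrightarrow> f X \<le> f_D M \<P> \<X> f X) \<Longrightarrow> dual_rep M \<X> (ca_c_on M \<P> \<X>) f"
  unfolding dual_rep_iff_f_D using f_D_le by (auto intro: antisym)

text \<open>
Passing from \<open>f\<close> to the smaller function \<open>f_E\<^sup>Q\<close> can only increase the dual function. It does not,
because the values of \<open>f_E\<^sup>Q\<close> at \<open>X\<close> are approximated by values of \<open>f\<close> at points \<open>Y\<close> with the same image
under \<open>j_Q\<close>, and \<open>\<mu>\<close> does not distinguish \<open>X\<close> from \<open>Y\<close>.
\<close>
lemma dual_fun_f_E:
  assumes Q: "Q \<in> prob_c M \<P>" and \<mu>: "\<mu> \<in> ca_Q_on M \<P> Q \<X>"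
  shows "dual_fun M \<X> (f_E \<X> f Q) \<mu> = dual_fun M \<X> f \<mu>"
proof (rule antisym)
  show "dual_fun M \<X> (f_E \<X> f Q) \<mu> \<le> dual_fun M \<X> f \<mu>"
    unfolding dual_fun_le_iff
  proof
    fix X assume X: "X \<in> \<X>"
    show "ereal (cls_integral M \<mu> X) - dual_fun M \<X> f \<mu> \<le> f_E \<X> f Q X"
      unfolding f_E_def
    proof (rule INF_greatest)
      fix r assume "r \<in> {r. j_map Q X \<in> j_map Q ` sublevel \<X> f r}"
      then obtain Y where Y: "Y \<in> \<X>" "f Y \<le> ereal r" "j_map Q X = j_map Q Y"
        by (auto simp: sublevel_def)
      have "ereal (cls_integral M \<mu> X) - dual_fun M \<X> f \<mu> = ereal (cls_integral M \<mu> Y) - dual_fun M \<X> f \<mu>"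
        using cls_integral_cong_j_map[OF Q \<mu> X Y(1,3)] by simp
      also have "\<dots> \<le> f Y"
        using dual_fun_le_iff[of f \<mu>] Y(1) by blast
      also note Y(2)
      finally show "ereal (cls_integral M \<mu> X) - dual_fun M \<X> f \<mu> \<le> ereal r" .
    qed
  qed
  show "dual_fun M \<X> f \<mu> \<le> dual_fun M \<X> (f_E \<X> f Q) \<mu>"
    unfolding dual_fun_le_iff
  proof
    fix X assume X: "X \<in> \<X>"
    have "f_E \<X> f Q X \<le> f X"
    proof (rule ereal_le_real)
      fix r assume "f X \<le> ereal r"
      then show "f_E \<X> f Q X \<le> ereal r"
        unfolding f_E_def using X by (intro INF_lower) (auto simp: sublevel_def)
    qed
    moreover have "ereal (cls_integral M \<mu> X) - dual_fun M \<X> (f_E \<X> f Q) \<mu> \<le> f_E \<X> f Q X"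
      using dual_fun_le_iff[of "f_E \<X> f Q" \<mu>] X by blast
    ultimately show "ereal (cls_integral M \<mu> X) - dual_fun M \<X> (f_E \<X> f Q) \<mu> \<le> f X"
      by order
  qed
qed

lemma f_QD_eq:
  assumes "Q \<in> prob_c M \<P>"
  shows "f_QD M \<P> \<X> f Q X = (SUP \<mu>\<in>ca_Q_on M \<P> Q \<X>. ereal (cls_integral M \<mu> X) - dual_fun M \<X> f \<mu>)"
  unfolding f_QD_def using dual_fun_f_E[OF assms] by (intro SUP_cong) auto

lemma f_QD_le_f_D:
  assumes "Q \<in> prob_c M \<P>"
  shows "f_QD M \<P> \<X> f Q X \<le> f_D M \<P> \<X> f X"
  unfolding f_QD_eq[OF assms] f_D_def by (intro SUP_subset_mono) (auto simp: ca_Q_on_def)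

lemma SUP_f_QD_eq_f_D: "(SUP Q\<in>prob_c M \<P>. f_QD M \<P> \<X> f Q X) = f_D M \<P> \<X> f X"
proof -
  have "(SUP Q\<in>prob_c M \<P>. f_QD M \<P> \<X> f Q X) = (SUP Q\<in>prob_c M \<P>. SUP \<mu>\<in>ca_Q_on M \<P> Q \<X>.
      ereal (cls_integral M \<mu> X) - dual_fun M \<X> f \<mu>)"
    by (intro SUP_cong refl f_QD_eq)
  also have "\<dots> = f_D M \<P> \<X> f X"
    unfolding f_D_def ca_c_on_eq_UN by (rule SUP_UNION[symmetric])
  finally show ?thesis .
qed

lemma dual_rep_iff_SUP_f_QD:
  "dual_rep M \<X> (ca_c_on M \<P> \<X>) f \<longleftrightarrow> (\<exists>\<Q>. \<Q> \<noteq> {} \<and> \<Q> \<subseteq> prob_c M \<P> \<and>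
     (\<forall>X\<in>\<X>. f X = (SUP Q\<in>\<Q>. f_QD M \<P> \<X> f Q X)))"
proof
  assume "dual_rep M \<X> (ca_c_on M \<P> \<X>) f"
  then show "\<exists>\<Q>. \<Q> \<noteq> {} \<and> \<Q> \<subseteq> prob_c M \<P> \<and> (\<forall>X\<in>\<X>. f X = (SUP Q\<in>\<Q>. f_QD M \<P> \<X> f Q X))"
    using prob_c_nonempty by (intro exI[of _ "prob_c M \<P>"]) (simp add: SUP_f_QD_eq_f_D dual_rep_iff_f_D)
next
  assume "\<exists>\<Q>. \<Q> \<noteq> {} \<and> \<Q> \<subseteq> prob_c M \<P> \<and> (\<forall>X\<in>\<X>. f X = (SUP Q\<in>\<Q>. f_QD M \<P> \<X> f Q X))"
  then show "dual_rep M \<X> (ca_c_on M \<P> \<X>) f"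
    by (intro dual_repI) (auto intro!: SUP_least f_QD_le_f_D)
qed

text \<open>
Each affine function in the representation only sees one image \<open>j_Q(X)\<close>. If for every \<open>Q\<close> this is
also the image of a point of the sublevel set, all these affine functions are at most \<open>r\<close> at \<open>X\<close>.
\<close>
lemma dual_rep_imp_reduction_set:
  assumes "dual_rep M \<X> (ca_c_on M \<P> \<X>) f"
  shows "reduction_set_fun M \<P> \<X> (prob_c M \<P>) f"
  unfolding reduction_set_fun_def reduction_set_def
proof (intro allI conjI ballI prob_c_nonempty order_refl iffI)
  fix r X assume X: "X \<in> \<X>" and *: "\<forall>Q\<in>prob_c M \<P>. j_map Q X \<in> j_map Q ` sublevel \<X> f r"
  have "f X = f_D M \<P> \<X> f X"
    using assms X by (simp add: dual_rep_iff_f_D)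
  also have "\<dots> \<le> ereal r"
    unfolding f_D_def ca_c_on_eq_UN
  proof (intro SUP_least)
    fix \<mu> assume "\<mu> \<in> (\<Union>Q\<in>prob_c M \<P>. ca_Q_on M \<P> Q \<X>)"
    then obtain Q where Q: "Q \<in> prob_c M \<P>" "\<mu> \<in> ca_Q_on M \<P> Q \<X>" by blast
    with * obtain Y where Y: "Y \<in> \<X>" "f Y \<le> ereal r" "j_map Q X = j_map Q Y"
      by (auto simp: sublevel_def)
    have "ereal (cls_integral M \<mu> X) - dual_fun M \<X> f \<mu> = ereal (cls_integral M \<mu> Y) - dual_fun M \<X> f \<mu>"
      using cls_integral_cong_j_map[OF Q X Y(1,3)] by simp
    also have "\<dots> \<le> f Y"
      using dual_fun_le_iff[of f \<mu>] Y(1) by blast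
    also note Y(2)
    finally show "ereal (cls_integral M \<mu> X) - dual_fun M \<X> f \<mu> \<le> ereal r" .
  qed
  finally show "X \<in> sublevel \<X> f r" using X by (simp add: sublevel_def)
qed auto

lemma dual_rep_iff_localization:
  "dual_rep M \<X> (ca_c_on M \<P> \<X>) f \<longleftrightarrow> sensitive_fun M \<P> \<X> f \<and>
     (\<exists>\<Q>. reduction_set_fun M \<P> \<X> \<Q> f \<and>
       (\<exists>fQ. localization \<X> \<Q> fQ f \<and> (\<forall>Q\<in>\<Q>. dual_rep M \<X> (ca_Q_on M \<P> Q \<X>) (fQ Q))))"
    (is "?L \<longleftrightarrow> ?R")
proof
  assume L: ?L
  have red: "reduction_set_fun M \<P> \<X> (prob_c M \<P>) f"
    using L by (rule dual_rep_imp_reduction_set)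
  then have "sensitive_fun M \<P> \<X> f"
    unfolding sensitive_fun_def sensitive_def reduction_set_fun_def reduction_set_def by blast
  moreover have "localization \<X> (prob_c M \<P>) (f_QD M \<P> \<X> f) f"
    unfolding localization_def consistent_def
  proof (intro conjI ballI impI)
    show "f X = (SUP Q\<in>prob_c M \<P>. f_QD M \<P> \<X> f Q X)" if "X \<in> \<X>" for X
      using L that by (simp add: SUP_f_QD_eq_f_D dual_rep_iff_f_D)
    show "f_QD M \<P> \<X> f Q X = f_QD M \<P> \<X> f Q Y"
      if "Q \<in> prob_c M \<P>" "X \<in> \<X>" "Y \<in> \<X>" "j_map Q X = j_map Q Y" for Q X Y
      unfolding f_QD_def using cls_integral_cong_j_map[OF that(1) _ that(2-4)]
      by (intro SUP_cong) auto
  qed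
  moreover have "dual_rep M \<X> (ca_Q_on M \<P> Q \<X>) (f_QD M \<P> \<X> f Q)" for Q
    unfolding dual_rep_def f_QD_def by (intro exI[of _ "dual_fun M \<X> (f_E \<X> f Q)"]) blast
  ultimately show ?R using red by blast
next
  assume ?R
  then obtain \<Q> fQ where \<Q>: "reduction_set_fun M \<P> \<X> \<Q> f" and loc: "localization \<X> \<Q> fQ f"
    and rep: "\<And>Q. Q \<in> \<Q> \<Longrightarrow> dual_rep M \<X> (ca_Q_on M \<P> Q \<X>) (fQ Q)"
    by blast
  show ?L
  proof (rule dual_repI)
    fix X assume X: "X \<in> \<X>"
    have f: "f Y = (SUP Q\<in>\<Q>. fQ Q Y)" if "Y \<in> \<X>" for Y
      using loc that by (simp add: localization_def)
    have "fQ Q X \<le> f_D M \<P> \<X> f X" if Q: "Q \<in> \<Q>" for Q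
    proof -
      obtain h where h: "\<And>Y. Y \<in> \<X> \<Longrightarrow>
          fQ Q Y = (SUP \<mu>\<in>ca_Q_on M \<P> Q \<X>. ereal (cls_integral M \<mu> Y) - h \<mu>)"
        using rep[OF Q] unfolding dual_rep_def by blast
      have "ereal (cls_integral M \<mu> X) - h \<mu> \<le> f_D M \<P> \<X> f X" if \<mu>: "\<mu> \<in> ca_Q_on M \<P> Q \<X>" for \<mu>
      proof (rule minorant_le_f_D)
        show "\<mu> \<in> ca_c_on M \<P> \<X>" using \<mu> by (simp add: ca_Q_on_def)
        fix Y assume Y: "Y \<in> \<X>"
        have "ereal (cls_integral M \<mu> Y) - h \<mu> \<le> fQ Q Y"
          unfolding h[OF Y] using \<mu> by (rule SUP_upper)
        also have "\<dots> \<le> f Y"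
          unfolding f[OF Y] using Q by (rule SUP_upper)
        finally show "ereal (cls_integral M \<mu> Y) - h \<mu> \<le> f Y" .
      qed
      then show ?thesis unfolding h[OF X] by (intro SUP_least)
    qed
    then show "f X \<le> f_D M \<P> \<X> f X"
      unfolding f[OF X] by (intro SUP_least)
  qed
qed

text \<open>
The map sends a function to the \<open>Q\<close>-class of its projection onto the space of representatives.
\<close>
lemma linear_parametrization:
  assumes Q: "Q \<in> prob_c M \<P>"
  obtains T :: "('a \<Rightarrow> real) \<Rightarrow> 'a rv_class" where
    "range T = j_map Q ` \<X>" "T 0 = const_cls (as_eq Q) 0"
    "\<And>x y. T (x + y) = add_cls (as_eq Q) (T x) (T y)"
    "\<And>a x. T (a *\<^sub>R x) = scale_cls (as_eq Q) a (T x)"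
proof -
  define V where "V = \<Union>\<X>"
  have refl: "(x, x) \<in> qs_eq M \<P>" if "x \<in> borel_measurable M" for x
    using equiv_qs that by (auto simp: equiv_def refl_on_def)
  have "subspace V"
  proof (rule subspaceI)
    have "(0 :: 'a \<Rightarrow> real) \<in> const_cls (qs_eq M \<P>) 0"
      unfolding const_cls_def using refl[of 0] by (simp add: zero_fun_def)
    then show "0 \<in> V"
      using linear_space unfolding V_def linear_space_def by blast
  next
    fix x y assume "x \<in> V" "y \<in> V"
    then obtain X Y where XY: "X \<in> \<X>" "Y \<in> \<X>" "x \<in> X" "y \<in> Y" unfolding V_def by blast
    then have "(\<lambda>\<omega>. x \<omega> + y \<omega>) \<in> borel_measurable M"
      using class_eq(1) by (intro borel_measurable_add) blast+
    from refl[OF this] have "x + y \<in> add_cls (qs_eq M \<P>) X Y"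
      using XY unfolding add_cls_def plus_fun_def by blast
    then show "x + y \<in> V"
      using linear_space XY unfolding V_def linear_space_def by blast
  next
    fix a and x :: "'a \<Rightarrow> real" assume "x \<in> V"
    then obtain X where X: "X \<in> \<X>" "x \<in> X" unfolding V_def by blast
    then have "(\<lambda>\<omega>. a * x \<omega>) \<in> borel_measurable M"
      using class_eq(1) by (intro borel_measurable_times borel_measurable_const) blast+
    from refl[OF this] have "a *\<^sub>R x \<in> scale_cls (qs_eq M \<P>) a X"
      using X unfolding scale_cls_def scaleR_fun_def real_scaleR_def by blast
    then show "a *\<^sub>R x \<in> V"
      using linear_space X unfolding V_def linear_space_def by blast
  qed
  then obtain \<pi> where \<pi>: "linear \<pi>" "range \<pi> = V" "\<And>v. v \<in> V \<Longrightarrow> \<pi> v = v"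
    by (rule projection_onto_subspace) blast
  have meas: "\<pi> x \<in> borel_measurable Q" for x
  proof -
    have "\<pi> x \<in> V" using \<pi>(2) by blast
    then show ?thesis
      using class_eq(1) borel_measurable_prob_c[OF Q] unfolding V_def by blast
  qed
  show thesis
  proof (rule that[of "\<lambda>x. as_eq Q `` {\<pi> x}"])
    have "range (\<lambda>x. as_eq Q `` {\<pi> x}) = (\<lambda>v. as_eq Q `` {v}) ` V"
      using \<pi>(2) by auto
    also have "\<dots> = j_map Q ` \<X>"
    proof
      show "(\<lambda>v. as_eq Q `` {v}) ` V \<subseteq> j_map Q ` \<X>"
        using j_map_eq[OF Q] unfolding V_def by blast
      show "j_map Q ` \<X> \<subseteq> (\<lambda>v. as_eq Q `` {v}) ` V"
        using j_map_eq[OF Q _ some_rep] some_rep unfolding V_def by blast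
    qed
    finally show "range (\<lambda>x. as_eq Q `` {\<pi> x}) = j_map Q ` \<X>" .
    show "as_eq Q `` {\<pi> 0} = const_cls (as_eq Q) 0"
      using linear_0[OF \<pi>(1)] by (simp add: const_cls_def zero_fun_def)
    show "as_eq Q `` {\<pi> (x + y)} = add_cls (as_eq Q) (as_eq Q `` {\<pi> x}) (as_eq Q `` {\<pi> y})" for x y
      by (simp add: linear_add[OF \<pi>(1)] add_cls_as_eq[OF meas meas])
    show "as_eq Q `` {\<pi> (a *\<^sub>R x)} = scale_cls (as_eq Q) a (as_eq Q `` {\<pi> x})" for a x
      by (simp add: linear_scale[OF \<pi>(1)] scale_cls_as_eq[OF meas])
  qed
qed

lemma ca_Q_on_of_dual_given_by:
  assumes Q: "Q \<in> prob_c M \<P>" and Y: "Y \<subseteq> ca_Q M Q" "dual_given_by M (as_eq Q) \<tau> Y"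
    and top: "topspace \<tau> = j_map Q ` \<X>" and \<mu>: "\<mu> \<in> Y"
  shows "\<mu> \<in> ca_Q_on M \<P> Q \<X>"
proof -
  have "signed_integrable M \<mu> x" if "X \<in> \<X>" "x \<in> X" for X x
  proof -
    have "x \<in> j_map Q X"
      using class_eq(1)[OF that] borel_measurable_prob_c[OF Q] j_map_eq[OF Q that]
      by (simp add: as_eq_def)
    then show ?thesis
      using Y(2) \<mu> that(1) top unfolding dual_given_by_def by blast
  qed
  then show ?thesis
    using Y(1) \<mu> ca_Q_subset_ca_c[OF Q] by (auto simp: ca_Q_on_def ca_c_on_def)
qed

text \<open>
By the Fenchel-Moreau theorem, \<open>g\<close> is approximated at \<open>X\<close> by continuous affine minorants. As the
dual space consists of integrals, these are of the form required by \<open>minorant_le_f_D\<close>.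
\<close>
lemma convex_lsc_le_f_D:
  assumes Q: "Q \<in> prob_c M \<P>"
    and lcs: "locally_convex_space (as_eq Q) (j_map Q ` \<X>) \<tau>"
    and Y: "Y \<subseteq> ca_Q M Q" "dual_given_by M (as_eq Q) \<tau> Y"
    and consistent: "consistent \<X> Q g"
    and convex: "convex_fun_cls (as_eq Q) (j_map Q ` \<X>) (induced \<X> Q g)"
    and lsc: "lower_semicont \<tau> (induced \<X> Q g)"
    and improper: "(\<exists>X\<in>\<X>. g X = - \<infinity>) \<longrightarrow> (\<forall>X\<in>\<X>. g X = - \<infinity>)"
    and le: "\<And>X. X \<in> \<X> \<Longrightarrow> g X \<le> f X"
    and X: "X \<in> \<X>"
  shows "g X \<le> f_D M \<P> \<X> f X"
proof (cases "\<exists>X\<in>\<X>. g X = - \<infinity>")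
  case True
  then show ?thesis using improper X by simp
next
  case False
  have top: "topspace \<tau> = j_map Q ` \<X>"
    using lcs by (simp add: locally_convex_space_def)
  have induced: "induced \<X> Q g (j_map Q Z) = g Z" if "Z \<in> \<X>" for Z
  proof -
    have mem: "j_map Q Z \<in> j_map Q ` \<X>" using that by blast
    have "g (inv_into \<X> (j_map Q) (j_map Q Z)) = g Z"
      using consistent[unfolded consistent_def, rule_format, OF inv_into_into[OF mem] that]
        f_inv_into_f[OF mem] by blast
    then show ?thesis by (simp add: induced_def)
  qed
  have below: "ereal r \<le> f_D M \<P> \<X> f X" if r: "ereal r < g X" for r
  proof -
    obtain T :: "('a \<Rightarrow> real) \<Rightarrow> 'a rv_class" where T: "range T = j_map Q ` \<X>"
        "T 0 = const_cls (as_eq Q) 0" "\<And>x y. T (x + y) = add_cls (as_eq Q) (T x) (T y)"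
        "\<And>a x. T (a *\<^sub>R x) = scale_cls (as_eq Q) a (T x)"
      using linear_parametrization[OF Q] by blast
    have "induced \<X> Q g Z \<noteq> - \<infinity>" if "Z \<in> j_map Q ` \<X>" for Z
      using that induced False by auto
    moreover have "j_map Q X \<in> j_map Q ` \<X>" "ereal r < induced \<X> Q g (j_map Q X)"
      using X r induced by auto
    ultimately obtain \<psi> c where psi: "\<psi> \<in> topological_dual (as_eq Q) \<tau>"
        "\<And>Z. Z \<in> j_map Q ` \<X> \<Longrightarrow> ereal (\<psi> Z + c) \<le> induced \<X> Q g Z" "r \<le> \<psi> (j_map Q X) + c"
      using locally_convex_affine_minorant[where T = T and g = "induced \<X> Q g", OF lcs T convex lsc]
      by blast
    obtain \<mu> where \<mu>: "\<mu> \<in> Y" "\<psi> = restrict (cls_integral M \<mu>) (topspace \<tau>)"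
      using psi(1) Y(2) unfolding dual_given_by_def by blast
    have psi_eq: "\<psi> (j_map Q Z) = cls_integral M \<mu> Z" if "Z \<in> \<X>" for Z
      using \<mu> Y(1) cls_integral_j_map[OF Q _ that, of \<mu>] that top by auto
    have "ereal r \<le> ereal (cls_integral M \<mu> X) - ereal (- c)"
      using psi(3) psi_eq[OF X] by simp
    also have "\<dots> \<le> f_D M \<P> \<X> f X"
    proof (rule minorant_le_f_D)
      show "\<mu> \<in> ca_c_on M \<P> \<X>"
        using ca_Q_on_of_dual_given_by[OF Q Y top \<mu>(1)] by (simp add: ca_Q_on_def)
      show "ereal (cls_integral M \<mu> Z) - ereal (- c) \<le> f Z" if "Z \<in> \<X>" for Z
        using psi(2)[of "j_map Q Z"] psi_eq[OF that] induced[OF that] le[OF that] that by simp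
    qed
    finally show ?thesis .
  qed
  show ?thesis
  proof (rule ccontr)
    assume "\<not> ?thesis"
    then obtain r where "f_D M \<P> \<X> f X < ereal r" "ereal r < g X"
      using ereal_dense2[of "f_D M \<P> \<X> f X" "g X"] by (auto simp: not_le)
    then show False using below[of r] by simp
  qed
qed

end

theorem theorem3p10:
  fixes M :: "'a measure" and \<P> :: "'a measure set"
    and \<X> :: "'a rv_class set" and f :: "'a rv_class \<Rightarrow> ereal"
  assumes "\<P> \<noteq> {}"
    and "\<forall>P\<in>\<P>. prob_space P \<and> sets P = sets M"
    and "\<X> \<subseteq> L0_c M \<P>"
    and "linear_space (qs_eq M \<P>) \<X>"
    and "\<forall>a. const_cls (qs_eq M \<P>) a \<in> \<X>"
  shows
    "(dual_rep M \<X> (ca_c_on M \<P> \<X>) f \<longleftrightarrow> (\<forall>X\<in>\<X>. f X = f_D M \<P> \<X> f X)) \<and>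
     (dual_rep M \<X> (ca_c_on M \<P> \<X>) f \<longleftrightarrow>
       (\<exists>\<Q>. \<Q> \<noteq> {} \<and> \<Q> \<subseteq> prob_c M \<P> \<and>
         (\<forall>X\<in>\<X>. f X = (SUP Q\<in>\<Q>. f_QD M \<P> \<X> f Q X)))) \<and>
     (dual_rep M \<X> (ca_c_on M \<P> \<X>) f \<longleftrightarrow>
       sensitive_fun M \<P> \<X> f \<and>
       (\<exists>\<Q>. reduction_set_fun M \<P> \<X> \<Q> f \<and>
         (\<exists>fQ. localization \<X> \<Q> fQ f \<and>
           (\<forall>Q\<in>\<Q>. dual_rep M \<X> (ca_Q_on M \<P> Q \<X>) (fQ Q))))) \<and>
     (\<forall>\<Q> \<tau> \<Y> fQ.
       \<Q> \<noteq> {} \<and> \<Q> \<subseteq> prob_c M \<P> \<and>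
       (\<forall>Q\<in>\<Q>. locally_convex_space (as_eq Q) (j_map Q ` \<X>) (\<tau> Q) \<and>
          \<Y> Q \<subseteq> ca_Q M Q \<and> dual_given_by M (as_eq Q) (\<tau> Q) (\<Y> Q)) \<and>
       localization \<X> \<Q> fQ f \<and>
       (\<forall>Q\<in>\<Q>. convex_fun_cls (as_eq Q) (j_map Q ` \<X>) (induced \<X> Q (fQ Q)) \<and>
          lower_semicont (\<tau> Q) (induced \<X> Q (fQ Q)) \<and>
          ((\<exists>X\<in>\<X>. fQ Q X = -\<infinity>) \<longrightarrow> (\<forall>X\<in>\<X>. fQ Q X = -\<infinity>)))
       \<longrightarrow> dual_rep M \<X> (ca_c_on M \<P> \<X>) f)"
proof -
  interpret linear_space_of_classes M \<P> \<X>
    using assms by unfold_locales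
  have sufficient: "dual_rep M \<X> (ca_c_on M \<P> \<X>) f"
    if \<Q>: "\<Q> \<subseteq> prob_c M \<P>"
      and dual: "\<forall>Q\<in>\<Q>. locally_convex_space (as_eq Q) (j_map Q ` \<X>) (\<tau> Q) \<and>
          \<Y> Q \<subseteq> ca_Q M Q \<and> dual_given_by M (as_eq Q) (\<tau> Q) (\<Y> Q)"
      and loc: "localization \<X> \<Q> fQ f"
      and fQ: "\<forall>Q\<in>\<Q>. convex_fun_cls (as_eq Q) (j_map Q ` \<X>) (induced \<X> Q (fQ Q)) \<and>
          lower_semicont (\<tau> Q) (induced \<X> Q (fQ Q)) \<and>
          ((\<exists>X\<in>\<X>. fQ Q X = -\<infinity>) \<longrightarrow> (\<forall>X\<in>\<X>. fQ Q X = -\<infinity>))"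
    for \<Q> \<tau> \<Y> fQ
  proof (rule dual_repI)
    fix X assume X: "X \<in> \<X>"
    have f: "f Y = (SUP Q\<in>\<Q>. fQ Q Y)" if "Y \<in> \<X>" for Y
      using loc that by (simp add: localization_def)
    show "f X \<le> f_D M \<P> \<X> f X"
      unfolding f[OF X]
    proof (rule SUP_least)
      fix Q assume Q: "Q \<in> \<Q>"
      show "fQ Q X \<le> f_D M \<P> \<X> f X"
      proof (rule convex_lsc_le_f_D[of Q "\<tau> Q" "\<Y> Q" "fQ Q"])
        show "fQ Q Y \<le> f Y" if "Y \<in> \<X>" for Y
          unfolding f[OF that] using Q by (rule SUP_upper)
        show "consistent \<X> Q (fQ Q)"
          using loc Q by (simp add: localization_def)
        show "Q \<in> prob_c M \<P>" using \<Q> Q by blast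
      qed (use bspec[OF dual Q] bspec[OF fQ Q] X in blast)+
    qed
  qed
  show ?thesis
    by (intro conjI allI impI dual_rep_iff_f_D dual_rep_iff_SUP_f_QD dual_rep_iff_localization;
      elim conjE; rule sufficient)
qed

end
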